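(* Let $n\geq 1$ and let $w\in S_n$ be any permutation. Let $R_w$ be the coordinate ring of the matrix Schubert variety $\mathfrak{X}_w\subseteq \mathsf{Mat}_n$. Then $R_w$ is Hilbertian.
   Context: $\mathsf{Mat}_n$ is the space of $n\times n$ matrices with entries in $\mathbb{C}$, and $GL_n\subseteq\mathsf{Mat}_n$ is the group of invertible matrices, with Borel subgroup $B$ of upper triangular matrices and opposite Borel subgroup $B_-$ of lower triangular matrices. The group $B_-\times B$ acts on $\mathsf{Mat}_n$ by $(b_-,b)\cdot M=b_-Mb^{-1}$. For $w\in S_n$ (the symmetric group on $[n]=\{1,\dots,n\}$), $M_w$ is the permutation matrix with $1$'s in positions $(i,w(i))$ and $0$'s elsewhere. The matrix Schubert variety $\mathfrak{X}_w$ is the (Zariski) closure in $\mathsf{Mat}_n$ of the $B_-\times B$-orbit of $M_w$. The Schubert determinantal ideal $I_w\subseteq\mathbb{C}[\mathsf{Mat}_n]=\mathbb{C}[z_{ij}:1\leq i,j\leq n]$ is the defining ideal of $\mathfrak{X}_w$, and $R_w=\mathbb{C}[\mathsf{Mat}_n]/I_w$. (By a theorem of Fulton, $I_w$ is prime and is generated by the minors of size $r_{ij}+1$ of $Z_{ij}$, $1\le i,j\le n$, where $Z_{ij}$ is the northwest $i\times j$ submatrix of the generic matrix $Z=(z_{ij})$ and $r_{ij}$ is the number of $1$'s in the northwest $i\times j$ submatrix of $M_w$; in particular $I_w$ is homogeneous.) Let $S=\mathbb{C}[x_1,\dots,x_N]$ be a standard graded polynomial ring, $I\subseteq S$ a homogeneous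 ideal, and $R=S/I=\bigoplus_{k\geq 0}R_k$. The Hilbert function is $HF_R(k)=\dim_{\mathbb{C}}(R_k)$ for $k\in\mathbb{Z}_{\ge 0}$. The Hilbert polynomial $HP_R$ is the unique polynomial with $HF_R(k)=HP_R(k)$ for all sufficiently large $k$. The ring $R$ is Hilbertian if $HF_R(k)=HP_R(k)$ for all $k\in\mathbb{Z}_{\geq 0}$. *)

theory Defs
  imports
    "Jordan_Normal_Form.Determinant"
    "HOL-Algebra.Embedded_Algebras"
    "HOL-Algebra.QuotRing"
    "HOL-Combinatorics.Permutations"
    "HOL-Computational_Algebra.Polynomial"
    "HOL-Library.Poly_Mapping"
begin

section \<open>Polynomial rings and Hilbert functions\<close>

text \<open>A monomial is its exponent vector, and a polynomial maps monomials to coefficients; the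
  product of the type class is the convolution product, that is, the product of polynomials.\<close>

type_synonym 'v monomial = "'v \<Rightarrow>\<^sub>0 nat"
type_synonym 'v cpoly = "'v monomial \<Rightarrow>\<^sub>0 complex"

text \<open>The ring \<open>\<complex>[x\<^sub>v : v \<in> V]\<close>.\<close>

definition polys_in :: "'v set \<Rightarrow> 'v cpoly ring" where
  "polys_in V =
    \<lparr>carrier = {p. \<forall>m \<in> Poly_Mapping.keys p. Poly_Mapping.keys m \<subseteq> V},
     mult = (*), one = 1, zero = 0, add = (+)\<rparr>"

definition eval_monomial :: "('v \<Rightarrow> complex) \<Rightarrow> 'v monomial \<Rightarrow> complex" where
  "eval_monomial a m = (\<Prod>v \<in> Poly_Mapping.keys m. a v ^ Poly_Mapping.lookup m v)"

definition eval_poly_at :: "('v \<Rightarrow> complex) \<Rightarrow> 'v cpoly \<Rightarrow> complex" where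
  "eval_poly_at a p =
    (\<Sum>m \<in> Poly_Mapping.keys p. Poly_Mapping.lookup p m * eval_monomial a m)"

definition total_degree :: "'v monomial \<Rightarrow> nat" where
  "total_degree m = (\<Sum>v \<in> Poly_Mapping.keys m. Poly_Mapping.lookup m v)"

text \<open>The graded piece \<open>S\<^sub>k\<close> of the standard graded ring \<open>S = \<complex>[x\<^sub>v : v \<in> V]\<close>.\<close>

definition forms :: "'v set \<Rightarrow> nat \<Rightarrow> 'v cpoly set" where
  "forms V k = {p \<in> carrier (polys_in V). \<forall>m \<in> Poly_Mapping.keys p. total_degree m = k}"

text \<open>For a homogeneous ideal \<open>I\<close>, the graded piece \<open>R\<^sub>k\<close> of \<open>R = S / I\<close> is the image of \<open>S\<^sub>k\<close>,
  and the ground field sits in \<open>R\<close> as the image of the constant polynomials.\<close>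

definition quot_graded_piece :: "'v set \<Rightarrow> 'v cpoly set \<Rightarrow> nat \<Rightarrow> 'v cpoly set set" where
  "quot_graded_piece V I k = (\<lambda>p. I +>\<^bsub>polys_in V\<^esub> p) ` forms V k"

definition quot_constants :: "'v set \<Rightarrow> 'v cpoly set \<Rightarrow> 'v cpoly set set" where
  "quot_constants V I =
    range (\<lambda>c::complex. I +>\<^bsub>polys_in V\<^esub> Poly_Mapping.single 0 c)"

definition hilbert_function :: "'v set \<Rightarrow> 'v cpoly set \<Rightarrow> nat \<Rightarrow> nat" where
  "hilbert_function V I k =
    ring.dim (polys_in V Quot I) (quot_constants V I) (quot_graded_piece V I k)"

definition hilbert_polynomial :: "'v set \<Rightarrow> 'v cpoly set \<Rightarrow> rat poly" where
  "hilbert_polynomial V I =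
    (THE P. \<forall>\<^sub>F k in sequentially. of_nat (hilbert_function V I k) = poly P (of_nat k))"

text \<open>The property of \<open>R = \<complex>[x\<^sub>v : v \<in> V] / I\<close>, for finite \<open>V\<close> and homogeneous \<open>I\<close>.\<close>

definition hilbertian :: "'v set \<Rightarrow> 'v cpoly set \<Rightarrow> bool" where
  "hilbertian V I \<longleftrightarrow>
    (\<forall>k. of_nat (hilbert_function V I k) = poly (hilbert_polynomial V I) (of_nat k))"


section \<open>Matrix Schubert varieties\<close>

text \<open>Rows and columns are indexed from \<open>0\<close>, as for all matrices of type \<^typ>\<open>complex mat\<close>,
  so that \<open>[n]\<close> is the set \<open>{..<n}\<close>.\<close>

abbreviation Mat :: "nat \<Rightarrow> complex mat set" where
  "Mat n \<equiv> carrier_mat n n"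

abbreviation mat_ring :: "nat \<Rightarrow> complex mat ring" where
  "mat_ring n \<equiv> ring_mat TYPE(complex) n ()"

definition GL :: "nat \<Rightarrow> complex mat set" where
  "GL n = Units (mat_ring n)"

definition Borel :: "nat \<Rightarrow> complex mat set" where
  "Borel n = {b \<in> GL n. upper_triangular b}"

definition Borel_opp :: "nat \<Rightarrow> complex mat set" where
  "Borel_opp n = {b \<in> GL n. upper_triangular (transpose_mat b)}"

definition orbit :: "nat \<Rightarrow> complex mat \<Rightarrow> complex mat set" where
  "orbit n M = {b' * M * inv\<^bsub>mat_ring n\<^esub> b | b' b. b' \<in> Borel_opp n \<and> b \<in> Borel n}"

definition perm_matrix :: "nat \<Rightarrow> (nat \<Rightarrow> nat) \<Rightarrow> complex mat" where
  "perm_matrix n w = mat n n (\<lambda>(i, j). if w i = j then 1 else 0)"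

text \<open>The index set of the variables \<open>z\<^sub>i\<^sub>j\<close> of \<open>\<complex>[Mat\<^sub>n]\<close>.\<close>

definition mat_vars :: "nat \<Rightarrow> (nat \<times> nat) set" where
  "mat_vars n = {..<n} \<times> {..<n}"

definition eval_at_mat :: "complex mat \<Rightarrow> (nat \<times> nat) cpoly \<Rightarrow> complex" where
  "eval_at_mat M = eval_poly_at (\<lambda>ij. M $$ ij)"

definition zariski_closed :: "nat \<Rightarrow> complex mat set \<Rightarrow> bool" where
  "zariski_closed n X \<longleftrightarrow>
    (\<exists>F \<subseteq> carrier (polys_in (mat_vars n)). X = {M \<in> Mat n. \<forall>f \<in> F. eval_at_mat M f = 0})"

definition matrix_schubert_variety :: "nat \<Rightarrow> (nat \<Rightarrow> nat) \<Rightarrow> complex mat set" where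
  "matrix_schubert_variety n w = zariski_closed n hull orbit n (perm_matrix n w)"

definition defining_ideal :: "nat \<Rightarrow> complex mat set \<Rightarrow> (nat \<times> nat) cpoly set" where
  "defining_ideal n X = {f \<in> carrier (polys_in (mat_vars n)). \<forall>M \<in> X. eval_at_mat M f = 0}"

definition schubert_ideal :: "nat \<Rightarrow> (nat \<Rightarrow> nat) \<Rightarrow> (nat \<times> nat) cpoly set" where
  "schubert_ideal n w = defining_ideal n (matrix_schubert_variety n w)"

end

theory Submission
  imports Defs "HOL-Library.Product_Lexorder"
begin

text \<open>The coordinate ring \<open>R\<^sub>w\<close> has a basis of standard monomials: the monomials whose support is a face of
the simplicial complex \<open>\<Delta>\<^sub>w\<close> of all sets of positions \<open>D\<close> such that, for all \<open>a\<close> and \<open>b\<close>, every antidiagonal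
chain of \<open>D\<close> in the northwest corner \<open>{..a} \<times> {..b}\<close> has at most as many elements as the rank of the corner of
the permutation matrix. This complex is a cone with apex \<open>v = (0, w 0)\<close>. So a standard monomial is a face
\<open>F\<close> without \<open>v\<close>, positive exponents on \<open>F\<close>, and an arbitrary exponent at \<open>v\<close>, and the number of
these of degree \<open>k\<close> is \<open>k choose card F\<close>. The sum of these binomial coefficients is a polynomial in \<open>k\<close> whose
values are right from \<open>k = 0\<close> on, while for a complex that is not a cone the value at \<open>k = 0\<close> can be wrong
(lemmas \<open>hilbert_function_eq_card_basis\<close> and \<open>card_standard_monomials\<close>).

Standard monomials span because a chain that is too long gives a minor that vanishes on the orbit, whose
antidiagonal term comes first in the lexicographic order of monomials along the rows of the matrix
(lemma \<open>nonstandard_monomial_reduces\<close>).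

They are independent because the first monomial of a polynomial that vanishes on the orbit of \<open>w\<close> is
never standard (lemma \<open>standard_leading_nonvanishing\<close>). This goes by induction on the variety and the
degree. The entries \<open>1\<close> of a permutation matrix are called its dots. Let \<open>(i, j)\<close> be the dot in the first nonzero row. The variables that
precede \<open>z\<^sub>i\<^sub>j\<close> vanish on the orbit, so they can be discarded, while \<open>z\<^sub>i\<^sub>j\<close> is nowhere zero there.
If \<open>z\<^sub>i\<^sub>j\<close> divides the first monomial, then by the choice of the order it divides all the others too,
and division lowers the degree. If it does not, then the support is still a face of the complex of some
\<open>w'\<close> that exchanges the dot with a dot to the southeast (lemma \<open>standard_swap\<close>); the orbit of \<open>w'\<close>
lies in the closure of the orbit of \<open>w\<close> (lemma \<open>vanishing_on_swap\<close>), so the polynomial vanishes there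
too, and the ranks of \<open>w'\<close> are smaller. This is the geometry of the co-transition formula, where the
variety is intersected with the hyperplane \<open>z\<^sub>i\<^sub>j = 0\<close>.

The induction leaves the permutations of \<open>{..<n}\<close>: setting a variable to zero leads to partial
permutation matrices. Hence \<open>w\<close> is a bijection of the natural numbers throughout, of which only the
\<open>n \<times> n\<close> corner of the infinite permutation matrix is seen by polynomials in \<open>mat_vars n\<close>. In this form a dot that moves
within its row or its column, or that disappears, is an exchange with a dot outside the corner.\<close>

section \<open>Northwest ranks and antidiagonals\<close>

definition nw_rank :: "(nat \<Rightarrow> nat) \<Rightarrow> nat \<Rightarrow> nat \<Rightarrow> nat" where
  "nw_rank w a b = card {s. s \<le> a \<and> w s \<le> b}"

definition antidiagonal :: "(nat \<times> nat) set \<Rightarrow> bool" where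
  "antidiagonal A \<longleftrightarrow> (\<forall>p\<in>A. \<forall>q\<in>A. p \<noteq> q \<longrightarrow>
     (fst p < fst q \<and> snd q < snd p) \<or> (fst q < fst p \<and> snd p < snd q))"

text \<open>The faces of the complex whose Stanley-Reisner ideal is generated by the antidiagonal products of the
  minors of size one more than the rank.\<close>

definition standard :: "(nat \<Rightarrow> nat) \<Rightarrow> (nat \<times> nat) set \<Rightarrow> bool" where
  "standard w D \<longleftrightarrow>
     (\<forall>A a b. A \<subseteq> D \<longrightarrow> antidiagonal A \<longrightarrow> A \<subseteq> {..a} \<times> {..b} \<longrightarrow> card A \<le> nw_rank w a b)"

lemma standardD:
  "standard w D \<Longrightarrow> A \<subseteq> D \<Longrightarrow> antidiagonal A \<Longrightarrow> A \<subseteq> {..a} \<times> {..b} \<Longrightarrow> card A \<le> nw_rank w a b"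
  unfolding standard_def by blast

lemma antidiagonal_subset: "antidiagonal A \<Longrightarrow> B \<subseteq> A \<Longrightarrow> antidiagonal B"
  unfolding antidiagonal_def by blast

lemma antidiagonal_inj_fst: "antidiagonal A \<Longrightarrow> inj_on fst A"
  unfolding antidiagonal_def inj_on_def by (metis less_irrefl)

lemma standard_subset: "standard w D \<Longrightarrow> D' \<subseteq> D \<Longrightarrow> standard w D'"
  unfolding standard_def by blast

lemma standard_rank_pos:
  assumes "standard w D" "p \<in> D" "fst p \<le> a" "snd p \<le> b"
  shows "0 < nw_rank w a b"
proof -
  have "card {p} \<le> nw_rank w a b"
    by (rule standardD[OF assms(1)]) (use assms in \<open>auto simp: antidiagonal_def mem_Times_iff\<close>)
  then show ?thesis by simp
qed

lemma bij_swap: "bij w \<Longrightarrow> bij (w \<circ> transpose i c)"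
  by (simp add: bij_comp)

text \<open>A corner that reaches row \<open>c\<close> has the rows of its dots permuted by the exchange. A corner that does not
  can only lose the dot of row \<open>i\<close>, and it does so if it contains this dot and ends before the new column \<open>w c\<close>.\<close>

lemma nw_rank_swap:
  assumes w: "bij w" and "i < c" and "w i < w c"
  shows "nw_rank (w \<circ> transpose i c) a b =
    nw_rank w a b - (if i \<le> a \<and> a < c \<and> w i \<le> b \<and> b < w c then 1 else 0)"
proof -
  let ?w' = "w \<circ> transpose i c"
  let ?S = "{s. s \<le> a \<and> w s \<le> b}" and ?S' = "{s. s \<le> a \<and> ?w' s \<le> b}"
  show ?thesis
  proof (cases "i \<le> a \<and> a < c \<and> w i \<le> b \<and> b < w c")
    case True
    then have "?S' = ?S - {i}" "i \<in> ?S"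
      using assms by (auto simp: transpose_def split: if_splits)
    then show ?thesis using True unfolding nw_rank_def by simp
  next
    case False
    have "card ?S' = card ?S"
    proof (cases "c \<le> a")
      case True
      have "?S' = transpose i c ` ?S"
      proof (rule subset_antisym; rule subsetI)
        fix s assume "s \<in> ?S'"
        then have "transpose i c s \<in> ?S"
          using True \<open>i < c\<close> by (auto simp: transpose_def split: if_splits)
        then show "s \<in> transpose i c ` ?S"
          by (metis image_eqI transpose_involutory)
      next
        fix s assume "s \<in> transpose i c ` ?S"
        then show "s \<in> ?S'"
          using True \<open>i < c\<close> by (auto simp: transpose_def split: if_splits)
      qed
      then show ?thesis
        using card_image[of "transpose i c" ?S] inj_on_subset[OF bij_is_inj[OF bij_transpose]]
        by simp
    next
      case c: False
      have "?S' = ?S"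
        using False c assms by (auto simp: transpose_def split: if_splits)
      then show ?thesis by simp
    qed
    then show ?thesis using False by (simp only: nw_rank_def) simp
  qed
qed

lemma rank_sum_swap:
  assumes "bij w" "i < c" "w i < w c" "i < n" "w i < n"
  shows "(\<Sum>a<n. \<Sum>b<n. nw_rank (w \<circ> transpose i c) a b) < (\<Sum>a<n. \<Sum>b<n. nw_rank w a b)"
proof (rule sum_strict_mono_ex1)
  have le: "nw_rank (w \<circ> transpose i c) a b \<le> nw_rank w a b" for a b
    using nw_rank_swap[OF assms(1-3), of a b] by simp
  show "\<forall>a\<in>{..<n}. (\<Sum>b<n. nw_rank (w \<circ> transpose i c) a b) \<le> (\<Sum>b<n. nw_rank w a b)"
    by (intro ballI sum_mono le)
  have "i \<in> {s. s \<le> i \<and> w s \<le> w i}" by simp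
  then have "0 < nw_rank w i (w i)" unfolding nw_rank_def
    by (intro card_gt_0_iff[THEN iffD2]) auto
  then have "nw_rank (w \<circ> transpose i c) i (w i) < nw_rank w i (w i)"
    using nw_rank_swap[OF assms(1-3), of i "w i"] assms by simp
  then have "(\<Sum>b<n. nw_rank (w \<circ> transpose i c) i b) < (\<Sum>b<n. nw_rank w i b)"
    using assms by (intro sum_strict_mono_ex1 ballI le) auto
  then show "\<exists>a\<in>{..<n}. (\<Sum>b<n. nw_rank (w \<circ> transpose i c) a b) < (\<Sum>b<n. nw_rank w a b)"
    using assms by auto
qed simp

text \<open>A corner of rank zero contains no element of a face.\<close>

lemma standard_first_row:
  assumes w: "bij w" and D: "standard w D" "D \<subseteq> mat_vars n"
    and rows: "\<forall>s<i. n \<le> w s" and p: "p \<in> D"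
  shows "i \<le> fst p" "fst p = i \<Longrightarrow> w i \<le> snd p"
proof -
  have n: "fst p < n" "snd p < n" using p D by (auto simp: mat_vars_def)
  have pos: "0 < nw_rank w (fst p) (snd p)"
    using standard_rank_pos[OF D(1) p] by simp
  then obtain s where s: "s \<le> fst p" "w s \<le> snd p"
    unfolding nw_rank_def by (auto simp: card_gt_0_iff)
  have "\<not> s < i" using s rows n by force
  then show "i \<le> fst p" "fst p = i \<Longrightarrow> w i \<le> snd p"
    using s by (auto simp: not_less)
qed

lemma exists_later_larger:
  assumes w: "bij (w :: nat \<Rightarrow> nat)"
  shows "\<exists>c>i. w c > j"
proof (rule ccontr)
  assume "\<not> ?thesis"
  then have "w ` {i<..} \<subseteq> {..j}" by force
  then have "finite (w ` {i<..})" using finite_subset by blast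
  then have "finite {i<..}"
    using finite_imageD bij_is_inj[OF w] by (metis inj_on_subset subset_UNIV)
  then show False by (simp add: infinite_Ioi)
qed

text \<open>The combinatorial core: a face that avoids the dot \<open>(i, w i)\<close> of the first nonzero row survives some
  exchange. Only corners whose rank drops matter, and for these it has to be shown that no chain of \<open>D\<close>
  attains the old rank.\<close>

lemma standard_swap:
  assumes w: "bij w" and D: "standard w D" "D \<subseteq> mat_vars n"
    and rows: "\<forall>s<i. n \<le> w s" and i: "w i < n" and notin: "(i, w i) \<notin> D"
  shows "\<exists>c>i. w i < w c \<and> standard (w \<circ> transpose i c) D"
proof -
  define j where "j = w i"
  have rowD: "i \<le> fst p" "fst p = i \<Longrightarrow> j < snd p" if "p \<in> D" for p
  proof -
    show "i \<le> fst p" using standard_first_row[OF w D rows that] by simp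
    assume "fst p = i"
    then have "j \<le> snd p" using standard_first_row[OF w D rows that] j_def by simp
    moreover have "snd p \<noteq> j" using notin that \<open>fst p = i\<close> j_def by (metis prod.collapse)
    ultimately show "j < snd p" by simp
  qed
  have finish: "standard (w \<circ> transpose i c) D"
    if c: "i < c" "j < w c"
      and tight: "\<And>A a b. A \<subseteq> D \<Longrightarrow> antidiagonal A \<Longrightarrow> A \<subseteq> {..a} \<times> {..b} \<Longrightarrow>
        i \<le> a \<Longrightarrow> a < c \<Longrightarrow> j \<le> b \<Longrightarrow> b < w c \<Longrightarrow> card A < nw_rank w a b" for c
    unfolding standard_def
  proof (intro allI impI)
    fix A a b assume A: "A \<subseteq> D" "antidiagonal A" "A \<subseteq> {..a} \<times> {..b}"
    have "card A \<le> nw_rank w a b" using standardD[OF D(1) A] .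
    moreover have "card A < nw_rank w a b" if "i \<le> a \<and> a < c \<and> w i \<le> b \<and> b < w c"
      using tight[OF A] that j_def by simp
    ultimately show "card A \<le> nw_rank (w \<circ> transpose i c) a b"
      using nw_rank_swap[OF w c(1), of a b] c j_def by auto
  qed
  show ?thesis
  proof (cases "\<exists>q. (i, q) \<in> D")
    case True
    define q where "q = (LEAST q. (i, q) \<in> D)"
    have q: "(i, q) \<in> D" and qmin: "\<And>y. (i, y) \<in> D \<Longrightarrow> q \<le> y"
      using True unfolding q_def by (auto intro: LeastI Least_le)
    have jq: "j < q" using rowD(2)[OF q] by simp
    have qn: "q < n" using q D by (auto simp: mat_vars_def)
    \<comment> \<open>The topmost dot in the columns \<open>j + 1, \<dots>, q\<close>. A chain that attains the rank of a corner above this dot and to its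
      left avoids row \<open>i\<close>, so \<open>(i, q)\<close> extends it, whereas the rank stays the same up to column \<open>q\<close>.\<close>
    define c where "c = (LEAST c. j < w c \<and> w c \<le> q)"
    have "\<exists>c. w c = q" using bij_is_surj[OF w] by (metis surjD)
    then have "\<exists>c. j < w c \<and> w c \<le> q" using jq by auto
    then have c: "j < w c" "w c \<le> q" and cmin: "\<And>s. j < w s \<Longrightarrow> w s \<le> q \<Longrightarrow> c \<le> s"
      unfolding c_def using LeastI_ex[of "\<lambda>c. j < w c \<and> w c \<le> q"] by (auto intro: Least_le)
    have "\<not> c < i" using rows c qn by force
    moreover have "c \<noteq> i" using c j_def by auto
    ultimately have ic: "i < c" by simp
    have "standard (w \<circ> transpose i c) D"
    proof (rule finish[OF ic c(1)])
      fix A a b assume A: "A \<subseteq> D" "antidiagonal A" "A \<subseteq> {..a} \<times> {..b}"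
        and ab: "i \<le> a" "a < c" "j \<le> b" "b < w c"
      have fin: "finite A" using A(3) finite_subset by blast
      have Aq: "i < fst p \<and> snd p < q" if "p \<in> A" for p
      proof -
        have "snd p < q" using that A(3) ab c by auto
        moreover have "i \<le> fst p" using rowD(1) that A(1) by blast
        moreover have "fst p \<noteq> i" using qmin[of "snd p"] that A(1) \<open>snd p < q\<close>
          by (metis leD prod.collapse subsetD)
        ultimately show ?thesis by simp
      qed
      let ?A = "insert (i, q) A"
      have "antidiagonal ?A"
        using A(2) Aq unfolding antidiagonal_def by auto
      moreover have "?A \<subseteq> {..a} \<times> {..q}" using A(3) ab c by auto
      ultimately have "card ?A \<le> nw_rank w a q" using standardD[OF D(1)] A(1) q by simp
      moreover have "(i, q) \<notin> A" using Aq[of "(i, q)"] by auto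
      moreover have "w s \<le> b" if "s \<le> a" "w s \<le> q" for s
      proof (rule ccontr)
        assume "\<not> w s \<le> b"
        then have "j < w s" using ab by simp
        then show False using cmin[of s] that ab by simp
      qed
      then have "{s. s \<le> a \<and> w s \<le> q} = {s. s \<le> a \<and> w s \<le> b}"
        using ab c by fastforce
      ultimately show "card A < nw_rank w a b"
        using fin by (simp add: nw_rank_def)
    qed
    then show ?thesis using ic c j_def by blast
  next
    case False
    \<comment> \<open>All dots strictly between the rows \<open>i\<close> and \<open>c\<close> lie to the left of column \<open>j\<close>, so the rank of the corners in question
      counts all rows from \<open>i\<close> on, but a chain has at most one element in each of them and none in row \<open>i\<close>.\<close>
    define c where "c = (LEAST c. i < c \<and> j < w c)"
    have c: "i < c" "j < w c" and cmin: "\<And>s. i < s \<Longrightarrow> j < w s \<Longrightarrow> c \<le> s"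
      using LeastI_ex[OF exists_later_larger[OF w, of i j]] unfolding c_def
      by (auto intro: Least_le)
    have "standard (w \<circ> transpose i c) D"
    proof (rule finish[OF c])
      fix A a b assume A: "A \<subseteq> D" "antidiagonal A" "A \<subseteq> {..a} \<times> {..b}"
        and ab: "i \<le> a" "a < c" "j \<le> b" "b < w c"
      have "fst ` A \<subseteq> {i<..a}"
      proof
        fix x assume "x \<in> fst ` A"
        then obtain y where "(x, y) \<in> A" by auto
        then have "(x, y) \<in> D" "x \<le> a" using A by auto
        then show "x \<in> {i<..a}" using rowD(1)[of "(x, y)"] False
          by (cases "x = i") auto
      qed
      then have "card (fst ` A) \<le> a - i" by (metis card_greaterThanAtMost card_mono finite_greaterThanAtMost)
      then have 1: "card A \<le> a - i" using card_image[OF antidiagonal_inj_fst[OF A(2)]] by simp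
      have "w s \<le> b" if "i \<le> s" "s \<le> a" for s
      proof (rule ccontr)
        assume "\<not> w s \<le> b"
        then have "j < w s" "s \<noteq> i" using ab j_def by auto
        then show False using cmin[of s] that ab by simp
      qed
      then have "{i..a} \<subseteq> {s. s \<le> a \<and> w s \<le> b}" by auto
      then have "card {i..a} \<le> nw_rank w a b" unfolding nw_rank_def by (intro card_mono) auto
      then show "card A < nw_rank w a b" using 1 ab by simp
    qed
    then show ?thesis using c j_def by blast
  qed
qed

section \<open>Monomials and evaluation\<close>

lemma eval_monomial_superset:
  assumes "finite V" "Poly_Mapping.keys m \<subseteq> V"
  shows "eval_monomial a m = (\<Prod>v\<in>V. a v ^ Poly_Mapping.lookup m v)"
  unfolding eval_monomial_def
  by (rule prod.mono_neutral_left) (use assms in \<open>auto simp: in_keys_iff\<close>)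

lemma total_degree_superset:
  assumes "finite V" "Poly_Mapping.keys m \<subseteq> V"
  shows "total_degree m = (\<Sum>v\<in>V. Poly_Mapping.lookup m v)"
  unfolding total_degree_def
  by (rule sum.mono_neutral_left) (use assms in \<open>auto simp: in_keys_iff\<close>)

lemma keys_add_nat:
  "Poly_Mapping.keys (m + m' :: 'v monomial) = Poly_Mapping.keys m \<union> Poly_Mapping.keys m'"
  by (auto simp: in_keys_iff lookup_add)

lemma eval_monomial_add: "eval_monomial a (m + m') = eval_monomial a m * eval_monomial a m'"
proof -
  let ?V = "Poly_Mapping.keys m \<union> Poly_Mapping.keys m'"
  have "eval_monomial a x = (\<Prod>v\<in>?V. a v ^ Poly_Mapping.lookup x v)"
    if "x \<in> {m, m', m + m'}" for x
    by (rule eval_monomial_superset) (use that in \<open>auto simp: keys_add_nat\<close>)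
  then show ?thesis by (simp add: lookup_add power_add prod.distrib)
qed

lemma total_degree_add: "total_degree (m + m') = total_degree m + total_degree m'"
proof -
  let ?V = "Poly_Mapping.keys m \<union> Poly_Mapping.keys m'"
  have "total_degree x = (\<Sum>v\<in>?V. Poly_Mapping.lookup x v)"
    if "x \<in> {m, m', m + m'}" for x
    by (rule total_degree_superset) (use that in \<open>auto simp: keys_add_nat\<close>)
  then show ?thesis by (simp add: lookup_add sum.distrib)
qed

lemma eval_monomial_single: "eval_monomial a (Poly_Mapping.single v e) = a v ^ e"
  by (cases "e = 0") (auto simp: eval_monomial_def)

lemma eval_monomial_0 [simp]: "eval_monomial a 0 = 1"
  by (simp add: eval_monomial_def)

lemma eval_monomial_eq_0:
  "v \<in> Poly_Mapping.keys m \<Longrightarrow> a v = 0 \<Longrightarrow> eval_monomial a m = 0"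
  unfolding eval_monomial_def by (auto simp: in_keys_iff)

lemma eval_monomial_sum: "eval_monomial a (\<Sum>x\<in>X. f x) = (\<Prod>x\<in>X. eval_monomial a (f x))"
  by (induction X rule: infinite_finite_induct) (auto simp: eval_monomial_add)

lemma eval_poly_at_superset:
  assumes "finite K" "Poly_Mapping.keys f \<subseteq> K"
  shows "eval_poly_at a f = (\<Sum>m\<in>K. Poly_Mapping.lookup f m * eval_monomial a m)"
  unfolding eval_poly_at_def
  by (rule sum.mono_neutral_left) (use assms in \<open>auto simp: in_keys_iff\<close>)

lemma eval_poly_at_add: "eval_poly_at a (f + g) = eval_poly_at a f + eval_poly_at a g"
proof -
  let ?K = "Poly_Mapping.keys f \<union> Poly_Mapping.keys g"
  have "eval_poly_at a h = (\<Sum>m\<in>?K. Poly_Mapping.lookup h m * eval_monomial a m)"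
    if "h \<in> {f, g, f + g}" for h
    by (rule eval_poly_at_superset) (use that Poly_Mapping.keys_add[of f g] in auto)
  then show ?thesis by (simp add: lookup_add distrib_right sum.distrib)
qed

lemma eval_poly_at_0 [simp]: "eval_poly_at a 0 = 0"
  by (simp add: eval_poly_at_def)

lemma eval_poly_at_single [simp]:
  "eval_poly_at a (Poly_Mapping.single m c) = c * eval_monomial a m"
  by (cases "c = 0") (auto simp: eval_poly_at_def)

lemma eval_poly_at_sum: "eval_poly_at a (\<Sum>x\<in>X. f x) = (\<Sum>x\<in>X. eval_poly_at a (f x))"
  by (induction X rule: infinite_finite_induct) (auto simp: eval_poly_at_add)

lemma total_degree_single [simp]: "total_degree (Poly_Mapping.single v e) = e"
  by (cases "e = 0") (auto simp: total_degree_def)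

lemma total_degree_0 [simp]: "total_degree 0 = 0"
  by (simp add: total_degree_def)

lemma total_degree_sum: "total_degree (\<Sum>x\<in>X. f x) = (\<Sum>x\<in>X. total_degree (f x))"
  by (induction X rule: infinite_finite_induct) (auto simp: total_degree_add)

text \<open>With \<^theory>\<open>HOL-Library.Product_Lexorder\<close> positions are ordered row by row, and of two monomials the smaller
  one has the smaller exponent at the first position where they differ. Among monomials of equal
  degree, the smallest monomial is therefore the leading one for the graded reverse lexicographic order in
  which the variables increase row by row.\<close>

lemma lex_less_monomialI:
  fixes m m' :: "'v::linorder monomial"
  assumes "Poly_Mapping.lookup m v < Poly_Mapping.lookup m' v"
    and "\<And>v'. v' < v \<Longrightarrow> Poly_Mapping.lookup m v' = Poly_Mapping.lookup m' v'"
  shows "m < m'"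
  using assms unfolding less_poly_mapping.rep_eq less_fun_def by blast

lemma finite_monomials_of_degree:
  assumes "finite V"
  shows "finite {m :: 'v monomial. Poly_Mapping.keys m \<subseteq> V \<and> total_degree m = k}"
proof (rule inj_on_finite)
  let ?S = "{m :: 'v monomial. Poly_Mapping.keys m \<subseteq> V \<and> total_degree m = k}"
  let ?f = "\<lambda>m v. if v \<in> V then Poly_Mapping.lookup m v else 0"
  show "inj_on ?f ?S"
  proof (rule inj_onI)
    fix m m' assume m: "m \<in> ?S" and m': "m' \<in> ?S" and eq: "?f m = ?f m'"
    show "m = m'"
    proof (rule poly_mapping_eqI)
      fix v
      show "Poly_Mapping.lookup m v = Poly_Mapping.lookup m' v"
      proof (cases "v \<in> V")
        case True
        then show ?thesis using fun_cong[OF eq, of v] by simp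
      next
        case False
        then have "v \<notin> Poly_Mapping.keys m" "v \<notin> Poly_Mapping.keys m'" using m m' by auto
        then show ?thesis by (simp add: in_keys_iff)
      qed
    qed
  qed
  let ?T = "{f. \<forall>v. (v \<in> V \<longrightarrow> f v \<in> {..k}) \<and> (v \<notin> V \<longrightarrow> f v = 0)}"
  show "finite ?T" by (rule finite_set_of_finite_funs) (use assms in auto)
  show "?f ` ?S \<subseteq> ?T"
  proof (rule image_subsetI)
    fix m assume "m \<in> ?S"
    then have "total_degree m = (\<Sum>v\<in>V. Poly_Mapping.lookup m v)" "total_degree m = k"
      using total_degree_superset[OF assms] by auto
    then have "Poly_Mapping.lookup m v \<le> k" if "v \<in> V" for v
      using member_le_sum[of v V "Poly_Mapping.lookup m"] that assms by auto
    then show "?f m \<in> ?T" by auto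
  qed
qed

lemma poly_eq_sum_singles:
  fixes f :: "'v cpoly"
  shows "f = (\<Sum>m\<in>Poly_Mapping.keys f. Poly_Mapping.single m (Poly_Mapping.lookup f m))"
  by (rule poly_mapping_eqI)
    (auto simp: lookup_sum lookup_single when_def in_keys_iff)

lemma eval_poly_at_mult: "eval_poly_at a (f * g) = eval_poly_at a f * eval_poly_at a g"
proof -
  let ?s = "\<lambda>h m. Poly_Mapping.single m (Poly_Mapping.lookup h m)"
  have prod: "f * g = (\<Sum>m\<in>Poly_Mapping.keys f. \<Sum>m'\<in>Poly_Mapping.keys g. ?s f m * ?s g m')"
    by (subst poly_eq_sum_singles[of f], subst poly_eq_sum_singles[of g]) (rule sum_product)
  show ?thesis
    unfolding prod eval_poly_at_sum mult_single eval_poly_at_single eval_monomial_add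
      eval_poly_at_def[of a f] eval_poly_at_def[of a g] sum_product
    by (simp add: mult_ac)
qed

lemma eval_poly_at_1 [simp]: "eval_poly_at a 1 = 1"
  using eval_poly_at_single[of a 0 1] by simp

lemma eval_poly_at_uminus: "eval_poly_at a (- f) = - eval_poly_at a f"
  using eval_poly_at_add[of a f "- f"] by (simp add: eq_neg_iff_add_eq_0 add.commute)

lemma eval_poly_at_diff: "eval_poly_at a (f - g) = eval_poly_at a f - eval_poly_at a g"
  using eval_poly_at_add[of a f "- g"] by (simp add: eval_poly_at_uminus)

lemma eval_poly_at_cong:
  assumes "f \<in> carrier (polys_in V)" "\<And>v. v \<in> V \<Longrightarrow> a v = b v"
  shows "eval_poly_at a f = eval_poly_at b f"
proof -
  have "eval_monomial a m = eval_monomial b m" if "m \<in> Poly_Mapping.keys f" for m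
  proof -
    have "Poly_Mapping.keys m \<subseteq> V" using assms(1) that by (simp add: polys_in_def)
    then show ?thesis
      unfolding eval_monomial_def by (intro prod.cong refl) (metis assms(2) subsetD)
  qed
  then show ?thesis unfolding eval_poly_at_def by (intro sum.cong) auto
qed

section \<open>Points of the orbit and their degenerations\<close>

definition lower :: "(nat \<Rightarrow> nat \<Rightarrow> complex) \<Rightarrow> bool" where
  "lower l \<longleftrightarrow> (\<forall>x s. x < s \<longrightarrow> l x s = 0) \<and> (\<forall>x. l x x \<noteq> 0)"

definition upper :: "(nat \<Rightarrow> nat \<Rightarrow> complex) \<Rightarrow> bool" where
  "upper u \<longleftrightarrow> (\<forall>r y. y < r \<longrightarrow> u r y = 0) \<and> (\<forall>y. u y y \<noteq> 0)"

text \<open>The entry at \<open>(x, y)\<close> of the product of \<open>l\<close>, the infinite permutation matrix of \<open>w\<close>, and \<open>u\<close>. The sum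
  stops at \<open>x\<close> because \<open>l\<close> will be lower triangular.\<close>

definition orbit_point ::
    "(nat \<Rightarrow> nat) \<Rightarrow> (nat \<Rightarrow> nat \<Rightarrow> complex) \<Rightarrow> (nat \<Rightarrow> nat \<Rightarrow> complex) \<Rightarrow> nat \<times> nat \<Rightarrow> complex" where
  "orbit_point w l u = (\<lambda>(x, y). \<Sum>s\<le>x. l x s * u (w s) y)"

definition orbit_points :: "(nat \<Rightarrow> nat) \<Rightarrow> (nat \<times> nat \<Rightarrow> complex) set" where
  "orbit_points w = {orbit_point w l u | l u. lower l \<and> upper u}"

lemma orbit_point_extend:
  assumes "lower l" "x \<le> N"
  shows "orbit_point w l u (x, y) = (\<Sum>s\<le>N. l x s * u (w s) y)"
  unfolding orbit_point_def prod.case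
  by (rule sum.mono_neutral_left) (use assms in \<open>auto simp: lower_def\<close>)

text \<open>In the rows \<open>i\<close>, \<open>c\<close> and the columns \<open>w i\<close>, \<open>w c\<close>, the block with rows \<open>(t, 1)\<close> and \<open>(1, 0)\<close> is, for
  \<open>t \<noteq> 0\<close>, the product of a lower and an upper triangular matrix, so adding \<open>t\<close> at the position \<open>(i, w i)\<close> to
  the permutation matrix after the exchange gives a point of the orbit before the exchange.
  The identity stays true when \<open>c\<close> or \<open>w c\<close> lies outside the corner of interest.\<close>

lemma orbit_degeneration:
  assumes w: "bij w" and ic: "i < c" "w i < w c" and l: "lower l" and u: "upper u" and t: "t \<noteq> 0"
  shows "(\<lambda>(x, y). orbit_point (w \<circ> transpose i c) l u (x, y) + t * (l x i * u (w i) y))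
    \<in> orbit_points w"
proof -
  \<comment> \<open>The triangular factors of the block have the rows \<open>(t, 0)\<close>, \<open>(1, -1/t)\<close> and \<open>(1, 1/t)\<close>, \<open>(0, 1)\<close>.\<close>
  define l' where "l' x s = (if s = i then t * l x i + l x c else if s = c then - (1/t) * l x c else l x s)"
    for x s
  define u' where "u' r y = (if r = w i then u (w i) y + (1/t) * u (w c) y else u r y)" for r y
  have l': "lower l'" using l ic t unfolding lower_def l'_def by auto
  have u': "upper u'" using u ic unfolding upper_def u'_def by auto
  have wi: "w s = w i \<longleftrightarrow> s = i" for s using bij_is_inj[OF w] by (simp add: inj_eq)
  have "orbit_point w l' u' (x, y) =
      orbit_point (w \<circ> transpose i c) l u (x, y) + t * (l x i * u (w i) y)" for x y
  proof -
    let ?N = "x + c"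
    let ?R = "{..?N} - {i} - {c}"
    have split: "(\<Sum>s\<le>?N. f s) = f i + (f c + (\<Sum>s\<in>?R. f s))" for f :: "nat \<Rightarrow> complex"
      using ic by (subst sum.remove[of _ i], simp, simp, subst sum.remove[of _ c]) auto
    have "(\<Sum>s\<in>?R. l' x s * u' (w s) y) = (\<Sum>s\<in>?R. l x s * u ((w \<circ> transpose i c) s) y)"
      by (rule sum.cong) (auto simp: l'_def u'_def wi transpose_def)
    then show ?thesis
      using ic t
      unfolding orbit_point_extend[OF l', of x ?N, simplified] orbit_point_extend[OF l, of x ?N, simplified] split
      by (simp add: l'_def u'_def wi field_simps)
  qed
  then have "(\<lambda>(x, y). orbit_point (w \<circ> transpose i c) l u (x, y) + t * (l x i * u (w i) y)) =
      orbit_point w l' u'" by auto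
  then show ?thesis using l' u' unfolding orbit_points_def by blast
qed

lemma orbit_points_nonempty: "\<exists>p. p \<in> orbit_points w"
proof -
  define l :: "nat \<Rightarrow> nat \<Rightarrow> complex" where "l x y = (if x = y then 1 else 0)" for x y
  have "lower l" "upper l" unfolding l_def lower_def upper_def by auto
  then show ?thesis unfolding orbit_points_def by blast
qed

text \<open>The coefficients may be zero and are read only on \<open>S\<close>, so that division by a variable is a mere reindexing.\<close>

definition eval_sum :: "('v monomial \<Rightarrow> complex) \<Rightarrow> 'v monomial set \<Rightarrow> ('v \<Rightarrow> complex) \<Rightarrow> complex" where
  "eval_sum c S p = (\<Sum>m\<in>S. c m * eval_monomial p m)"

text \<open>The orbit after the exchange consists of limits of points of the orbit before it, and a polynomial is
  continuous along the degeneration.\<close>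

lemma vanishing_on_swap:
  assumes w: "bij w" and ic: "i < c" "w i < w c"
    and van: "\<And>p. p \<in> orbit_points w \<Longrightarrow> eval_sum a S p = 0"
    and p: "p \<in> orbit_points (w \<circ> transpose i c)"
  shows "eval_sum a S p = 0"
proof -
  obtain l u where l: "lower l" and u: "upper u" and p: "p = orbit_point (w \<circ> transpose i c) l u"
    using p unfolding orbit_points_def by auto
  define q where "q t = (\<lambda>(x, y). p (x, y) + t * (l x i * u (w i) y))" for t
  have q: "q t \<in> orbit_points w" if "t \<noteq> 0" for t
    using orbit_degeneration[OF w ic l u that] unfolding q_def p by simp
  have "continuous (at 0) (\<lambda>t. eval_sum a S (q t))"
    unfolding eval_sum_def eval_monomial_def q_def split_def by (intro continuous_intros)
  then have lim: "((\<lambda>t. eval_sum a S (q t)) \<longlongrightarrow> eval_sum a S (q 0)) (at 0)"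
    by (simp add: continuous_within)
  have "\<forall>\<^sub>F t in at 0. eval_sum a S (q t) = 0"
    using van[OF q] by (auto simp: eventually_at_filter)
  then have "((\<lambda>t. eval_sum a S (q t)) \<longlongrightarrow> 0) (at 0)"
    by (rule tendsto_eventually)
  with lim have "eval_sum a S (q 0) = 0" using tendsto_unique[of "at (0::complex)"] by auto
  moreover have "q 0 = p" unfolding q_def by auto
  ultimately show ?thesis by simp
qed

text \<open>Above row \<open>i\<close> all dots lie to the right of the columns considered, and in row \<open>i\<close> only the dot \<open>(i, w i)\<close>
  contributes, which reaches the columns from \<open>w i\<close> on; its own entry is a product of two diagonal entries.\<close>

lemma orbit_point_first_row:
  assumes p: "p \<in> orbit_points w" and rows: "\<forall>s<i. n \<le> w s" and i: "w i < n"
  shows "p (i, w i) \<noteq> 0"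
    and "v < (i, w i) \<Longrightarrow> v \<in> mat_vars n \<Longrightarrow> p v = 0"
proof -
  obtain l u where l: "lower l" and u: "upper u" and p: "p = orbit_point w l u"
    using p unfolding orbit_points_def by auto
  have u0: "u (w s) y = 0" if "s < i" "y < n" for s y
  proof -
    have "y < w s" using rows that by fastforce
    then show ?thesis using u unfolding upper_def by blast
  qed
  have "p (i, y) = l i i * u (w i) y" if "y < n" for y
  proof -
    have "p (i, y) = (\<Sum>s\<in>{i}. l i s * u (w s) y)"
      unfolding p orbit_point_def prod.case
      by (rule sum.mono_neutral_right) (use u0 that in auto)
    then show ?thesis by simp
  qed
  note row = this
  show "p (i, w i) \<noteq> 0" using row[OF i] l u unfolding lower_def upper_def by simp
  assume v: "v < (i, w i)" "v \<in> mat_vars n"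
  obtain x y where xy: "v = (x, y)" "x < n" "y < n" using v by (auto simp: mat_vars_def)
  consider "x < i" | "x = i" "y < w i" using v xy by (cases "x = i") (auto simp: less_prod_def)
  then show "p v = 0"
  proof cases
    case 1
    then show ?thesis unfolding p orbit_point_def xy using u0 xy by auto
  next
    case 2
    then show ?thesis using row[of y] u xy unfolding upper_def by auto
  qed
qed

section \<open>Leading terms of functions that vanish on the orbit\<close>

text \<open>The induction runs over all bijections and all coefficients at once: an exchange of dots keeps the polynomial
  and lowers the sum of the ranks, and division by the variable of a dot keeps the bijection and lowers the degree.
  By contraposition, no polynomial that vanishes on the orbit has a standard first monomial.\<close>

lemma standard_leading_nonvanishing:
  assumes "bij w" and "finite S" "S \<noteq> {}" and "\<forall>m\<in>S. Poly_Mapping.keys m \<subseteq> mat_vars n"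
    and "standard w (Poly_Mapping.keys (Min S))" and "c (Min S) \<noteq> 0"
  shows "\<exists>p\<in>orbit_points w. eval_sum c S p \<noteq> 0"
  using assms
proof (induction "(\<Sum>a<n. \<Sum>b<n. nw_rank w a b) + total_degree (Min S)"
    arbitrary: w S c rule: less_induct)
  case (less w S c)
  note w = less.prems(1) and fin = less.prems(2) and ne = less.prems(3) and vars = less.prems(4)
    and std = less.prems(5) and lead = less.prems(6)
  let ?m = "Min S"
  have mS: "?m \<in> S" using fin ne by simp
  have mvars: "Poly_Mapping.keys ?m \<subseteq> mat_vars n" using vars mS by blast
  show ?case
  proof (cases "\<exists>i<n. w i < n")
    case False
    \<comment> \<open>Without a dot in the \<open>n \<times> n\<close> corner, the orbit is the zero matrix there and only \<open>1\<close> is standard.\<close>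
    have "Poly_Mapping.keys ?m = {}"
    proof (rule ccontr)
      assume "Poly_Mapping.keys ?m \<noteq> {}"
      then obtain v where v: "v \<in> Poly_Mapping.keys ?m" by blast
      then have "0 < nw_rank w (fst v) (snd v)" using standard_rank_pos[OF std] by simp
      then obtain s where "s \<le> fst v" "w s \<le> snd v"
        unfolding nw_rank_def by (auto simp: card_gt_0_iff)
      moreover have "fst v < n" "snd v < n" using v mvars by (auto simp: mat_vars_def)
      ultimately show False using False by (meson le_less_trans)
    qed
    then have m0: "?m = 0" by simp
    obtain p where p: "p \<in> orbit_points w" using orbit_points_nonempty by blast
    have p0: "p v = 0" if "v \<in> mat_vars n" for v
    proof -
      obtain l u where u: "upper u" and pt: "p = orbit_point w l u"
        using p unfolding orbit_points_def by auto
      have "u (w s) (snd v) = 0" if "s \<le> fst v" for s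
      proof -
        have "s < n" "snd v < n" using \<open>v \<in> mat_vars n\<close> that by (auto simp: mat_vars_def)
        then have "snd v < w s" using False by (meson le_less_trans not_less)
        then show ?thesis using u unfolding upper_def by blast
      qed
      then show ?thesis unfolding pt orbit_point_def split_def by simp
    qed
    have "eval_sum c S p = (\<Sum>m\<in>{?m}. c m * eval_monomial p m)"
      unfolding eval_sum_def
    proof (rule sum.mono_neutral_right)
      show "\<forall>m\<in>S - {?m}. c m * eval_monomial p m = 0"
      proof
        fix m assume m: "m \<in> S - {?m}"
        then have "Poly_Mapping.keys m \<noteq> {}" using m0 by auto
        then obtain v where "v \<in> Poly_Mapping.keys m" by blast
        then show "c m * eval_monomial p m = 0"
          using p0[of v] vars m eval_monomial_eq_0[of v m p] by auto
      qed
    qed (use fin mS in auto)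
    then have "eval_sum c S p \<noteq> 0" using lead m0 by simp
    then show ?thesis using p by blast
  next
    case True
    define i where "i = (LEAST i. w i < n)"
    have i: "w i < n" and rows: "\<forall>s<i. n \<le> w s"
      using LeastI_ex[of "\<lambda>i. w i < n"] not_less_Least[of _ "\<lambda>i. w i < n"] True
      unfolding i_def not_less[symmetric] by blast+
    have "i < n"
    proof -
      obtain k where "k < n" "w k < n" using True by blast
      then show ?thesis using Least_le[of "\<lambda>i. w i < n" k] unfolding i_def by simp
    qed
    let ?v = "(i, w i)"
    show ?thesis
    proof (cases "?v \<in> Poly_Mapping.keys ?m")
      case False
      then obtain k where k: "i < k" "w i < w k"
          and std': "standard (w \<circ> transpose i k) (Poly_Mapping.keys ?m)"
        using standard_swap[OF w std mvars rows i] by blast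
      have "\<exists>p\<in>orbit_points (w \<circ> transpose i k). eval_sum c S p \<noteq> 0"
        using rank_sum_swap[OF w k \<open>i < n\<close> i]
        by (intro less.hyps bij_swap w fin ne vars std' lead) simp
      then show ?thesis using vanishing_on_swap[OF w k] by metis
    next
      case True
      let ?e = "Poly_Mapping.single ?v (1::nat)"
      \<comment> \<open>The monomials in the variables from \<open>?v\<close> on; the others vanish on the orbit by \<open>orbit_point_first_row\<close>.\<close>
      define S1 where "S1 = {m\<in>S. \<forall>v\<in>Poly_Mapping.keys m. ?v \<le> v}"
      have "?v \<le> v" if "v \<in> Poly_Mapping.keys ?m" for v
        using standard_first_row[OF w std mvars rows that]
        unfolding less_eq_prod_def by (cases "fst v = i") auto
      then have mS1: "?m \<in> S1" using mS unfolding S1_def by blast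
      have S1: "finite S1" "S1 \<subseteq> S" using fin unfolding S1_def by auto
      have div: "?e + (m - ?e) = m" if m: "m \<in> S1" for m
      proof -
        have "Poly_Mapping.lookup m ?v \<noteq> 0"
        proof
          \<comment> \<open>A monomial of \<open>S1\<close> without \<open>?v\<close> would be smaller than the minimum, which contains it.\<close>
          assume 0: "Poly_Mapping.lookup m ?v = 0"
          have "m < ?m"
          proof (rule lex_less_monomialI[of _ ?v])
            show "Poly_Mapping.lookup m ?v < Poly_Mapping.lookup ?m ?v"
              using 0 True by (simp add: in_keys_iff)
            fix v' assume "v' < ?v"
            then have "v' \<notin> Poly_Mapping.keys m" "v' \<notin> Poly_Mapping.keys ?m"
              using m mS1 unfolding S1_def by auto
            then show "Poly_Mapping.lookup m v' = Poly_Mapping.lookup ?m v'"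
              by (simp add: in_keys_iff)
          qed
          moreover have "?m \<le> m" using m fin S1 by auto
          ultimately show False by simp
        qed
        then show ?thesis
          by (intro poly_mapping_eqI)
            (auto simp: lookup_add lookup_minus lookup_single when_def)
      qed
      \<comment> \<open>On the orbit, the polynomial is \<open>p ?v\<close>, which is not zero, times the quotient with the monomials \<open>S2\<close>.\<close>
      define S2 where "S2 = (\<lambda>m. m - ?e) ` S1"
      have inj: "inj_on (\<lambda>m. m - ?e) S1"
        by (rule inj_on_inverseI[where g = "\<lambda>m. ?e + m"]) (rule div)
      have m2: "Min S2 = ?m - ?e"
      proof (rule Min_eqI)
        show "finite S2" using S1 unfolding S2_def by simp
        show "?m - ?e \<in> S2" using mS1 unfolding S2_def by simp
        fix x assume "x \<in> S2"
        then obtain m where m: "m \<in> S1" "x = m - ?e" unfolding S2_def by blast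
        have "?e + (?m - ?e) \<le> ?e + (m - ?e)"
          unfolding div[OF mS1] div[OF m(1)] using m fin S1 by auto
        then show "?m - ?e \<le> x" using m by simp
      qed
      have keys2: "Poly_Mapping.keys (m - ?e) \<subseteq> Poly_Mapping.keys m" if "m \<in> S1" for m
        using div[OF that] keys_add_nat[of ?e "m - ?e"] by auto
      have "\<exists>p\<in>orbit_points w. eval_sum (\<lambda>m. c (?e + m)) S2 p \<noteq> 0"
      proof (rule less.hyps)
        show "(\<Sum>a<n. \<Sum>b<n. nw_rank w a b) + total_degree (Min S2)
            < (\<Sum>a<n. \<Sum>b<n. nw_rank w a b) + total_degree ?m"
          unfolding m2 using total_degree_add[of ?e "?m - ?e"] div[OF mS1] by simp
        show "finite S2" "S2 \<noteq> {}" using S1 mS1 unfolding S2_def by auto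
        show "\<forall>m\<in>S2. Poly_Mapping.keys m \<subseteq> mat_vars n"
          using keys2 vars S1 unfolding S2_def by blast
        show "standard w (Poly_Mapping.keys (Min S2))"
          unfolding m2 using standard_subset[OF std keys2[OF mS1]] .
        show "c (?e + Min S2) \<noteq> 0" unfolding m2 div[OF mS1] by (rule lead)
      qed (rule w)
      then obtain p where p: "p \<in> orbit_points w" and ne2: "eval_sum (\<lambda>m. c (?e + m)) S2 p \<noteq> 0"
        by blast
      have "eval_sum c S p = (\<Sum>m\<in>S1. c m * eval_monomial p m)"
        unfolding eval_sum_def
      proof (rule sum.mono_neutral_right)
        show "\<forall>m\<in>S - S1. c m * eval_monomial p m = 0"
        proof
          fix m assume m: "m \<in> S - S1"
          then obtain v where v: "v \<in> Poly_Mapping.keys m" "v < ?v"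
            unfolding S1_def by auto
          then have "p v = 0" using orbit_point_first_row(2)[OF p rows i] vars m by blast
          then show "c m * eval_monomial p m = 0" using eval_monomial_eq_0[OF v(1)] by simp
        qed
      qed (use S1 fin in auto)
      also have "\<dots> = (\<Sum>m\<in>S1. p ?v * (c (?e + (m - ?e)) * eval_monomial p (m - ?e)))"
      proof (rule sum.cong[OF refl])
        fix m assume "m \<in> S1"
        then have "eval_monomial p m = p ?v * eval_monomial p (m - ?e)"
          using eval_monomial_add[of p ?e "m - ?e"] div by (simp add: eval_monomial_single)
        then show "c m * eval_monomial p m = p ?v * (c (?e + (m - ?e)) * eval_monomial p (m - ?e))"
          using div[OF \<open>m \<in> S1\<close>] by simp
      qed
      also have "\<dots> = p ?v * eval_sum (\<lambda>m. c (?e + m)) S2 p"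
        unfolding eval_sum_def S2_def sum.reindex[OF inj] by (simp add: sum_distrib_left)
      finally have "eval_sum c S p \<noteq> 0"
        using ne2 orbit_point_first_row(1)[OF p rows i] by (metis mult_eq_0_iff)
      then show ?thesis using p by blast
    qed
  qed
qed

section \<open>Straightening by minors\<close>

text \<open>Up to row \<open>a\<close> and column \<open>b\<close> only the dots of that corner contribute to a point of the orbit. Hence
  the \<open>k \<times> k\<close> submatrix factors through a space of smaller dimension; padded by zeros, the left factor is a
  square matrix with a zero column.\<close>

lemma orbit_point_minor_vanishes:
  assumes p: "p \<in> orbit_points w" and k: "nw_rank w a b < k"
    and R: "\<And>x. x < k \<Longrightarrow> R x \<le> a" and C: "\<And>x. x < k \<Longrightarrow> C x \<le> b"
  shows "(\<Sum>\<sigma>\<in>{\<sigma>. \<sigma> permutes {0..<k}}. signof \<sigma> * (\<Prod>x = 0..<k. p (R x, C (\<sigma> x)))) = 0"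
proof -
  obtain l u where l: "lower l" and u: "upper u" and p: "p = orbit_point w l u"
    using p unfolding orbit_points_def by auto
  define Dots where "Dots = {s. s \<le> a \<and> w s \<le> b}"
  have fin: "finite Dots" unfolding Dots_def by simp
  define r where "r = card Dots"
  have rk: "r < k" using k unfolding r_def Dots_def nw_rank_def .
  obtain e where e: "bij_betw e {0..<r} Dots"
    using ex_bij_betw_nat_finite[OF fin] unfolding r_def by blast
  define X where "X = mat k k (\<lambda>(x, t). if t < r then l (R x) (e t) else 0)"
  define Y where "Y = mat k k (\<lambda>(t, y). if t < r then u (w (e t)) (C y) else 0)"
  have XY: "X \<in> carrier_mat k k" "Y \<in> carrier_mat k k" unfolding X_def Y_def by auto
  have entry: "(X * Y) $$ (x, y) = p (R x, C y)" if xy: "x < k" "y < k" for x y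
  proof -
    have "(X * Y) $$ (x, y) = (\<Sum>t = 0..<k. X $$ (x, t) * Y $$ (t, y))"
      using xy XY by (simp add: scalar_prod_def)
    also have "\<dots> = (\<Sum>t = 0..<r. X $$ (x, t) * Y $$ (t, y))"
      by (rule sum.mono_neutral_right) (use rk xy in \<open>auto simp: X_def\<close>)
    also have "\<dots> = (\<Sum>t = 0..<r. l (R x) (e t) * u (w (e t)) (C y))"
      by (rule sum.cong) (use rk xy in \<open>auto simp: X_def Y_def\<close>)
    also have "\<dots> = (\<Sum>s\<in>Dots. l (R x) s * u (w s) (C y))"
      using sum.reindex_bij_betw[OF e, of "\<lambda>s. l (R x) s * u (w s) (C y)"] by simp
    also have "\<dots> = (\<Sum>s\<le>a. l (R x) s * u (w s) (C y))"
    proof (rule sum.mono_neutral_left)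
      show "\<forall>s\<in>{..a} - Dots. l (R x) s * u (w s) (C y) = 0"
      proof
        fix s assume "s \<in> {..a} - Dots"
        then have "C y < w s" using C[OF xy(2)] unfolding Dots_def by auto
        then show "l (R x) s * u (w s) (C y) = 0" using u unfolding upper_def by simp
      qed
    qed (auto simp: Dots_def)
    also have "\<dots> = p (R x, C y)"
      unfolding p by (rule orbit_point_extend[OF l R[OF xy(1)], symmetric])
    finally show ?thesis .
  qed
  have "det X = 0"
    unfolding det_def'[OF XY(1)]
  proof (rule sum.neutral, rule ballI)
    fix \<sigma> assume "\<sigma> \<in> {\<sigma>. \<sigma> permutes {0..<k}}"
    then have perm: "\<sigma> permutes {0..<k}" by simp
    have "k - 1 \<in> \<sigma> ` {0..<k}" unfolding permutes_image[OF perm] using rk by simp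
    then obtain x where x: "x < k" "\<sigma> x = k - 1" by auto
    then have "X $$ (x, \<sigma> x) = 0" using rk unfolding X_def by simp
    then have "(\<Prod>x = 0..<k. X $$ (x, \<sigma> x)) = 0" using x by (intro prod_zero bexI[of _ x]) auto
    then show "signof \<sigma> * (\<Prod>x = 0..<k. X $$ (x, \<sigma> x)) = 0" by simp
  qed
  then have "det (X * Y) = 0" using det_mult[OF XY] by simp
  moreover have "det (X * Y) = (\<Sum>\<sigma>\<in>{\<sigma>. \<sigma> permutes {0..<k}}.
      signof \<sigma> * (\<Prod>x = 0..<k. p (R x, C (\<sigma> x))))"
    unfolding det_def'[OF mult_carrier_mat[OF XY]]
  proof (intro sum.cong refl arg_cong2[where f = "(*)"] prod.cong)
    fix \<sigma> x assume "\<sigma> \<in> {\<sigma>. \<sigma> permutes {0..<k}}" "x \<in> {0..<k}"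
    then show "(X * Y) $$ (x, \<sigma> x) = p (R x, C (\<sigma> x))"
      using permutes_in_image[of \<sigma> "{0..<k}" x] by (intro entry) auto
  qed
  ultimately show ?thesis by simp
qed

text \<open>The term of \<open>\<sigma>\<close> in the Leibniz expansion of the minor with rows \<open>R\<close> and columns \<open>C\<close>. The columns are
  listed in decreasing order, so the identity gives the antidiagonal.\<close>

definition transversal_monomial ::
    "nat \<Rightarrow> (nat \<Rightarrow> nat) \<Rightarrow> (nat \<Rightarrow> nat) \<Rightarrow> (nat \<Rightarrow> nat) \<Rightarrow> (nat \<times> nat) monomial" where
  "transversal_monomial k R C \<sigma> = (\<Sum>x = 0..<k. Poly_Mapping.single (R x, C (\<sigma> x)) 1)"

lemma lookup_transversal_monomial:
  "Poly_Mapping.lookup (transversal_monomial k R C \<sigma>) v =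
    (\<Sum>x = 0..<k. if (R x, C (\<sigma> x)) = v then 1 else 0)"
  unfolding transversal_monomial_def lookup_sum lookup_single when_def ..

lemma eval_transversal_monomial:
  "eval_monomial p (transversal_monomial k R C \<sigma>) = (\<Prod>x = 0..<k. p (R x, C (\<sigma> x)))"
  unfolding transversal_monomial_def eval_monomial_sum eval_monomial_single by simp

lemma total_degree_transversal [simp]: "total_degree (transversal_monomial k R C \<sigma>) = k"
  unfolding transversal_monomial_def total_degree_sum by simp

text \<open>At the first row \<open>x\<close> that \<open>\<sigma>\<close> moves, the columns with smaller index are used up, so \<open>\<sigma> x > x\<close>: in this row the
  term of \<open>\<sigma>\<close> has its variable to the left of the antidiagonal, where the antidiagonal term has exponent zero.\<close>

lemma antidiagonal_leads_minor:
  assumes R: "\<And>x y. x < y \<Longrightarrow> y < k \<Longrightarrow> R x < R y"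
    and C: "\<And>x y. x < y \<Longrightarrow> y < k \<Longrightarrow> C y < C x"
    and \<sigma>: "\<sigma> permutes {0..<k}" "\<sigma> \<noteq> id"
  shows "transversal_monomial k R C id < transversal_monomial k R C \<sigma>"
proof -
  have "\<exists>x. \<sigma> x \<noteq> x" using \<sigma>(2) by (auto simp: fun_eq_iff)
  define x where "x = (LEAST x. \<sigma> x \<noteq> x)"
  have x: "\<sigma> x \<noteq> x" using \<open>\<exists>x. \<sigma> x \<noteq> x\<close> unfolding x_def by (rule LeastI_ex)
  have below: "\<sigma> y = y" if "y < x" for y using not_less_Least that unfolding x_def by blast
  have xk: "x < k" using x permutes_not_in[OF \<sigma>(1)] by force
  have sk: "\<sigma> x < k" using permutes_in_image[OF \<sigma>(1)] xk by simp
  have "\<not> \<sigma> x < x"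
    using below[of "\<sigma> x"] x permutes_inj[OF \<sigma>(1)] by (auto simp: inj_eq)
  then have gt: "x < \<sigma> x" using x by simp
  have Rinj: "R y = R z \<longleftrightarrow> y = z" if "y < k" "z < k" for y z
    using R[of y z] R[of z y] that by (cases y z rule: linorder_cases) auto
  have Cx: "C (\<sigma> x) < C x" using C[OF gt sk] .
  let ?v = "(R x, C (\<sigma> x))"
  show ?thesis
  proof (rule lex_less_monomialI[of _ ?v])
    have "Poly_Mapping.lookup (transversal_monomial k R C id) ?v = 0"
      unfolding lookup_transversal_monomial using Rinj xk Cx by (auto intro!: sum.neutral)
    moreover have "(if (R x, C (\<sigma> x)) = ?v then 1 else 0) \<le>
        (\<Sum>y = 0..<k. if (R y, C (\<sigma> y)) = ?v then 1 else (0::nat))"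
      by (rule member_le_sum) (use xk in auto)
    ultimately show "Poly_Mapping.lookup (transversal_monomial k R C id) ?v
        < Poly_Mapping.lookup (transversal_monomial k R C \<sigma>) ?v"
      unfolding lookup_transversal_monomial by simp
    fix v' assume v': "v' < ?v"
    have "(R y, C (id y)) = v' \<longleftrightarrow> (R y, C (\<sigma> y)) = v'" if "y < k" for y
    proof (cases "y < x")
      case True
      then show ?thesis using below by simp
    next
      case False
      then have "R x < R y \<or> y = x" using R[of x y] that by (cases "y = x") auto
      then show ?thesis using v' Cx by (cases v') (auto simp: less_prod_def)
    qed
    then show "Poly_Mapping.lookup (transversal_monomial k R C id) v'
        = Poly_Mapping.lookup (transversal_monomial k R C \<sigma>) v'"
      unfolding lookup_transversal_monomial by (intro sum.cong) auto
  qed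
qed

text \<open>One straightening step: an antidiagonal chain that is too long divides \<open>m\<close>, and the relation given by its
  vanishing minor replaces the chain by larger monomials of the same degree.\<close>

lemma nonstandard_monomial_reduces:
  assumes m: "Poly_Mapping.keys m \<subseteq> mat_vars n" and nstd: "\<not> standard w (Poly_Mapping.keys m)"
  shows "\<exists>q. (\<forall>m'\<in>Poly_Mapping.keys q. m < m' \<and> total_degree m' = total_degree m
      \<and> Poly_Mapping.keys m' \<subseteq> mat_vars n)
    \<and> (\<forall>p\<in>orbit_points w. eval_monomial p m = eval_poly_at p q)"
proof -
  obtain A a b where A: "A \<subseteq> Poly_Mapping.keys m" "antidiagonal A" "A \<subseteq> {..a} \<times> {..b}"
    and card: "nw_rank w a b < card A"
    using nstd unfolding standard_def by (auto simp: not_le)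
  have fin: "finite A" using A(1) finite_keys finite_subset by blast
  define k where "k = card A"
  define xs where "xs = sorted_list_of_set A"
  have xs: "set xs = A" "length xs = k" "distinct xs" "sorted_wrt (<) xs"
    using fin unfolding xs_def k_def by auto
  define R where "R x = fst (xs ! x)" for x
  define C where "C x = snd (xs ! x)" for x
  have inA: "(R x, C x) \<in> A" if "x < k" for x
    using that xs unfolding R_def C_def by (metis nth_mem prod.collapse)
  have strict: "R x < R y \<and> C y < C x" if "x < y" "y < k" for x y
  proof -
    have "xs ! x < xs ! y" using xs that by (simp add: sorted_wrt_nth_less)
    then have "(R x, C x) < (R y, C y)" unfolding R_def C_def by simp
    moreover have "(R x, C x) \<noteq> (R y, C y)" using calculation by auto
    then have "(R x < R y \<and> C y < C x) \<or> (R y < R x \<and> C x < C y)"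
      using A(2) inA[of x] inA[of y] that unfolding antidiagonal_def by fastforce
    ultimately show ?thesis by (auto simp: less_prod_def)
  qed
  let ?t = "transversal_monomial k R C"
  have "?t id = (\<Sum>x = 0..<k. Poly_Mapping.single (xs ! x) 1)"
    unfolding transversal_monomial_def R_def C_def by simp
  also have "\<dots> = (\<Sum>v\<in>A. Poly_Mapping.single v 1)"
    by (rule sum.reindex_bij_betw, rule bij_betw_nth) (use xs in auto)
  finally have tid: "Poly_Mapping.lookup (?t id) v = (if v \<in> A then 1 else 0)" for v
    using fin by (simp add: lookup_sum lookup_single when_def)
  define rest where "rest = m - ?t id"
  have m_eq: "m = ?t id + rest"
  proof (rule poly_mapping_eqI)
    fix v
    have "v \<in> A \<Longrightarrow> Poly_Mapping.lookup m v \<noteq> 0" using A(1) by (auto simp: in_keys_iff)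
    then show "Poly_Mapping.lookup m v = Poly_Mapping.lookup (?t id + rest) v"
      unfolding rest_def lookup_add lookup_minus tid by auto
  qed
  let ?P = "{\<sigma>. \<sigma> permutes {0..<k}}"
  define q where "q = (\<Sum>\<sigma>\<in>?P - {id}. Poly_Mapping.single (?t \<sigma> + rest) (- signof \<sigma> :: complex))"
  have finP: "finite ?P" by (simp add: finite_permutations)
  have "eval_monomial p m = eval_poly_at p q" if p: "p \<in> orbit_points w" for p
  proof -
    have "(\<Sum>\<sigma>\<in>?P. signof \<sigma> * (\<Prod>x = 0..<k. p (R x, C (\<sigma> x)))) = 0"
      by (rule orbit_point_minor_vanishes[OF p, of a b])
        (use card inA A(3) in \<open>auto simp: k_def\<close>)
    then have "0 = (\<Sum>\<sigma>\<in>?P. signof \<sigma> * eval_monomial p (?t \<sigma>)) * eval_monomial p rest"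
      unfolding eval_transversal_monomial by simp
    also have "\<dots> = (\<Sum>\<sigma>\<in>?P. signof \<sigma> * eval_monomial p (?t \<sigma> + rest))"
      unfolding eval_monomial_add sum_distrib_right by (simp add: mult.assoc)
    also have "\<dots> = eval_monomial p m + (\<Sum>\<sigma>\<in>?P - {id}. signof \<sigma> * eval_monomial p (?t \<sigma> + rest))"
      using finP by (subst sum.remove[of _ id]) (auto simp: permutes_id m_eq[symmetric])
    finally show ?thesis
      unfolding q_def eval_poly_at_sum by (simp add: sum_negf eq_neg_iff_add_eq_0)
  qed
  moreover have "m < m' \<and> total_degree m' = total_degree m \<and> Poly_Mapping.keys m' \<subseteq> mat_vars n"
    if m'q: "m' \<in> Poly_Mapping.keys q" for m'
  proof -
    have "Poly_Mapping.keys q \<subseteq>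
        (\<Union>\<sigma>\<in>?P - {id}. Poly_Mapping.keys (Poly_Mapping.single (?t \<sigma> + rest) (- signof \<sigma> :: complex)))"
      unfolding q_def by (rule Poly_Mapping.keys_sum)
    then obtain \<sigma> where \<sigma>: "\<sigma> permutes {0..<k}" "\<sigma> \<noteq> id" and m': "m' = ?t \<sigma> + rest"
      using m'q by (auto split: if_splits)
    have "?t id < ?t \<sigma>" by (rule antidiagonal_leads_minor[OF _ _ \<sigma>]) (use strict in auto)
    then have "m < m'" unfolding m' by (subst m_eq) (rule add_strict_right_mono)
    moreover have "total_degree m' = total_degree m"
      unfolding m' by (subst m_eq) (simp add: total_degree_add)
    moreover have "Poly_Mapping.keys (?t \<sigma>) \<subseteq> mat_vars n"
    proof
      fix v assume "v \<in> Poly_Mapping.keys (?t \<sigma>)"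
      then have "Poly_Mapping.lookup (?t \<sigma>) v \<noteq> 0" by (simp add: in_keys_iff)
      then obtain x where x: "x < k" "v = (R x, C (\<sigma> x))"
        unfolding lookup_transversal_monomial by (auto elim: sum.not_neutral_contains_not_neutral split: if_splits)
      then have "\<sigma> x < k" using permutes_in_image[OF \<sigma>(1)] by simp
      then have "(R x, C x) \<in> mat_vars n" "(R (\<sigma> x), C (\<sigma> x)) \<in> mat_vars n"
        using inA x A(1) m by blast+
      then show "v \<in> mat_vars n" using x unfolding mat_vars_def by simp
    qed
    moreover have "Poly_Mapping.keys rest \<subseteq> mat_vars n"
      using m keys_add_nat[of "?t id" rest] m_eq by auto
    ultimately show ?thesis unfolding m' keys_add_nat by simp
  qed
  ultimately show ?thesis by blast
qed

section \<open>Hilbert functions of vanishing ideals\<close>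

lemma carrier_polys_in:
  "f \<in> carrier (polys_in V) \<longleftrightarrow> (\<forall>m\<in>Poly_Mapping.keys f. Poly_Mapping.keys m \<subseteq> V)"
  by (simp add: polys_in_def)

lemma polys_in_simps [simp]:
  "mult (polys_in V) = (*)" "one (polys_in V) = 1"
  "zero (polys_in V) = 0" "add (polys_in V) = (+)"
  by (simp_all add: polys_in_def)

lemma polys_in_closed:
  assumes "f \<in> carrier (polys_in V)" "g \<in> carrier (polys_in V)"
  shows "f + g \<in> carrier (polys_in V)" "f * g \<in> carrier (polys_in V)"
    "- f \<in> carrier (polys_in V)"
proof -
  show "f + g \<in> carrier (polys_in V)"
    using assms Poly_Mapping.keys_add[of f g] unfolding carrier_polys_in by blast
  show "- f \<in> carrier (polys_in V)"
    using assms unfolding carrier_polys_in by (simp add: keys_minus)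
  show "f * g \<in> carrier (polys_in V)"
    unfolding carrier_polys_in
  proof
    fix m assume "m \<in> Poly_Mapping.keys (f * g)"
    then obtain x y where "m = x + y" "x \<in> Poly_Mapping.keys f" "y \<in> Poly_Mapping.keys g"
      using Poly_Mapping.keys_mult[of f g] by auto
    then show "Poly_Mapping.keys m \<subseteq> V"
      using assms unfolding carrier_polys_in by (auto simp: keys_add_nat)
  qed
qed

lemma polys_in_single:
  "Poly_Mapping.keys m \<subseteq> V \<Longrightarrow> Poly_Mapping.single m c \<in> carrier (polys_in V)"
  by (simp add: carrier_polys_in)

lemma polys_in_0_1: "0 \<in> carrier (polys_in V)" "1 \<in> carrier (polys_in V)"
  by (simp_all add: carrier_polys_in)

lemma polys_in_cring: "cring (polys_in V)"
proof (rule cringI)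
  show "abelian_group (polys_in V)"
  proof (rule abelian_groupI)
    fix f assume f: "f \<in> carrier (polys_in V)"
    show "\<exists>g\<in>carrier (polys_in V). g \<oplus>\<^bsub>polys_in V\<^esub> f = \<zero>\<^bsub>polys_in V\<^esub>"
      using polys_in_closed(3)[OF f f] by (intro bexI[of _ "- f"]) auto
  qed (auto simp: polys_in_closed add_ac polys_in_0_1)
  show "comm_monoid (polys_in V)"
    by (rule comm_monoidI) (auto simp: polys_in_closed mult_ac polys_in_0_1)
qed (simp add: distrib_right)

lemma polys_in_a_minus:
  assumes "f \<in> carrier (polys_in V)" "g \<in> carrier (polys_in V)"
  shows "f \<ominus>\<^bsub>polys_in V\<^esub> g = f - g"
proof -
  interpret cring "polys_in V" by (rule polys_in_cring)
  have "\<ominus>\<^bsub>polys_in V\<^esub> g = - g"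
    by (rule minus_equality) (use assms polys_in_closed(3)[of g V g] in auto)
  then show ?thesis by (simp add: a_minus_def)
qed

definition vanishing_ideal :: "'v set \<Rightarrow> ('v \<Rightarrow> complex) set \<Rightarrow> 'v cpoly set" where
  "vanishing_ideal V Z = {f \<in> carrier (polys_in V). \<forall>p\<in>Z. eval_poly_at p f = 0}"

lemma vanishing_ideal_ideal: "ideal (vanishing_ideal V Z) (polys_in V)"
proof -
  interpret cring "polys_in V" by (rule polys_in_cring)
  show ?thesis
  proof (rule idealI)
    show "subgroup (vanishing_ideal V Z) (add_monoid (polys_in V))"
    proof (rule add.subgroupI)
      show "vanishing_ideal V Z \<noteq> {}"
        using zero_closed by (auto simp: vanishing_ideal_def intro!: exI[of _ 0])
      fix f assume f: "f \<in> vanishing_ideal V Z"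
      have "\<ominus>\<^bsub>polys_in V\<^esub> f = - f"
        by (rule minus_equality)
          (use f polys_in_closed(3)[of f V f] in \<open>auto simp: vanishing_ideal_def\<close>)
      then show "\<ominus>\<^bsub>polys_in V\<^esub> f \<in> vanishing_ideal V Z"
        using f polys_in_closed(3)[of f V f] by (auto simp: vanishing_ideal_def eval_poly_at_uminus)
    qed (auto simp: vanishing_ideal_def polys_in_closed eval_poly_at_add)
  qed (auto simp: vanishing_ideal_def polys_in_closed eval_poly_at_mult ring_axioms)
qed

lemma vanishing_ideal_coset_eq_iff:
  assumes f: "f \<in> carrier (polys_in V)" and g: "g \<in> carrier (polys_in V)"
  shows "vanishing_ideal V Z +>\<^bsub>polys_in V\<^esub> f = vanishing_ideal V Z +>\<^bsub>polys_in V\<^esub> g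
    \<longleftrightarrow> (\<forall>p\<in>Z. eval_poly_at p f = eval_poly_at p g)"
proof -
  have "f - g \<in> carrier (polys_in V)"
    using polys_in_closed(1)[OF f polys_in_closed(3)[OF g g]] by simp
  then have "f - g \<in> vanishing_ideal V Z \<longleftrightarrow> (\<forall>p\<in>Z. eval_poly_at p f = eval_poly_at p g)"
    by (simp add: vanishing_ideal_def eval_poly_at_diff)
  moreover have "f - g \<in> vanishing_ideal V Z \<longleftrightarrow>
      vanishing_ideal V Z +>\<^bsub>polys_in V\<^esub> f = vanishing_ideal V Z +>\<^bsub>polys_in V\<^esub> g"
    using ring.quotient_eq_iff_same_a_r_cos[OF cring.axioms(1)[OF polys_in_cring]
        vanishing_ideal_ideal[of V Z] f g]
    unfolding polys_in_a_minus[OF f g] .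
  ultimately show ?thesis by metis
qed

lemma constants_subfield:
  "subfield (range (Poly_Mapping.single 0)) (polys_in V)"
proof -
  interpret cring "polys_in V" by (rule polys_in_cring)
  let ?K = "range (Poly_Mapping.single (0 :: 'a monomial)) :: 'a cpoly set"
  have neg: "\<ominus>\<^bsub>polys_in V\<^esub> (Poly_Mapping.single 0 c) = Poly_Mapping.single 0 (- c)" for c :: complex
    by (rule minus_equality) (auto simp: polys_in_single single_add[symmetric])
  have sub: "subring ?K (polys_in V)"
  proof (rule subringI)
    show "\<one>\<^bsub>polys_in V\<^esub> \<in> ?K" by (auto intro!: image_eqI[of _ _ 1])
  qed (auto simp: polys_in_single neg mult_single single_add[symmetric])
  show ?thesis
  proof (rule subfieldI)
    show "subcring ?K (polys_in V)" by (rule subcringI'[OF sub])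
    show "Units (polys_in V \<lparr>carrier := ?K\<rparr>) = ?K - {\<zero>\<^bsub>polys_in V\<^esub>}"
    proof (rule subset_antisym; rule subsetI)
      fix f assume "f \<in> Units (polys_in V \<lparr>carrier := ?K\<rparr>)"
      then show "f \<in> ?K - {\<zero>\<^bsub>polys_in V\<^esub>}"
        unfolding Units_def by auto
    next
      fix f assume "f \<in> ?K - {\<zero>\<^bsub>polys_in V\<^esub>}"
      then obtain c where f: "f = Poly_Mapping.single 0 c" "f \<noteq> 0" by auto
      then have c: "f = Poly_Mapping.single 0 c" "c \<noteq> 0" by auto
      have "Poly_Mapping.single 0 (1/c) * f = 1" "f * Poly_Mapping.single 0 (1/c) = 1"
        using c by (simp_all add: mult_single)
      then show "f \<in> Units (polys_in V \<lparr>carrier := ?K\<rparr>)"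
        unfolding Units_def using c by auto
    qed
  qed
qed

text \<open>Adjoining the monomials of \<open>B\<close> one at a time adds one dimension each, which is how dimension over a
  subfield is built up; the ideal is proper because \<open>Z\<close> has a point.\<close>

lemma hilbert_function_eq_card_basis:
  fixes V :: "'v set" and B :: "'v monomial set"
  assumes fin: "finite B" and B: "\<And>m. m \<in> B \<Longrightarrow> Poly_Mapping.keys m \<subseteq> V \<and> total_degree m = k"
    and ne: "Z \<noteq> {}"
    and indep: "\<And>f. Poly_Mapping.keys f \<subseteq> B \<Longrightarrow> (\<forall>p\<in>Z. eval_poly_at p f = 0) \<Longrightarrow> f = 0"
    and span: "\<And>f. f \<in> forms V k \<Longrightarrow>
      \<exists>g. Poly_Mapping.keys g \<subseteq> B \<and> (\<forall>p\<in>Z. eval_poly_at p f = eval_poly_at p g)"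
  shows "hilbert_function V (vanishing_ideal V Z) k = card B"
proof -
  let ?R = "polys_in V" and ?I = "vanishing_ideal V Z"
  interpret R: cring ?R by (rule polys_in_cring)
  interpret I: ideal ?I ?R by (rule vanishing_ideal_ideal)
  let ?Q = "?R Quot ?I"
  define \<phi> where "\<phi> f = ?I +>\<^bsub>?R\<^esub> f" for f
  interpret h: ring_hom_ring ?R ?Q \<phi>
    using I.rcos_ring_hom_ring unfolding \<phi>_def[abs_def] .
  have \<phi>_eq: "\<phi> f = \<phi> g \<longleftrightarrow> (\<forall>p\<in>Z. eval_poly_at p f = eval_poly_at p g)"
    if "f \<in> carrier ?R" "g \<in> carrier ?R" for f g
    unfolding \<phi>_def by (rule vanishing_ideal_coset_eq_iff[OF that])
  define K where "K = quot_constants V ?I"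
  have K: "K = \<phi> ` range (Poly_Mapping.single 0)"
    unfolding K_def quot_constants_def \<phi>_def by auto
  have one_zero: "\<one>\<^bsub>?Q\<^esub> \<noteq> \<zero>\<^bsub>?Q\<^esub>"
  proof -
    have "\<not> (\<forall>p\<in>Z. eval_poly_at p 1 = eval_poly_at p 0)" using ne by simp
    then have "\<phi> \<one>\<^bsub>?R\<^esub> \<noteq> \<phi> \<zero>\<^bsub>?R\<^esub>"
      using \<phi>_eq[OF R.one_closed R.zero_closed] by simp
    then show ?thesis unfolding h.hom_one h.hom_zero .
  qed
  have field: "subfield K ?Q"
    unfolding K by (rule h.img_is_subfield(2)[OF constants_subfield one_zero])
  have inR: "f \<in> carrier ?R" if "Poly_Mapping.keys f \<subseteq> B" for f
    using that B unfolding carrier_polys_in by blast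
  have dimension: "h.S.dimension (card B') K (\<phi> ` {f. Poly_Mapping.keys f \<subseteq> B'})" if "B' \<subseteq> B" for B'
  proof -
    have "finite B'" using that fin finite_subset by blast
    then show ?thesis using that
    proof (induction B')
      case empty
      have "\<phi> ` {f. Poly_Mapping.keys f \<subseteq> {}} = {\<zero>\<^bsub>?Q\<^esub>}"
        using h.hom_zero by (simp add: subset_empty)
      then show ?case using h.S.dimension.zero_dim by simp
    next
      case (insert m B')
      let ?E = "\<phi> ` {f. Poly_Mapping.keys f \<subseteq> B'}"
      let ?v = "\<phi> (Poly_Mapping.single m 1)"
      have m: "Poly_Mapping.single m c \<in> carrier ?R" for c
        using insert.prems B by (intro polys_in_single) blast
      have sub: "f \<in> carrier ?R" if "Poly_Mapping.keys f \<subseteq> B'" for f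
        using that insert.prems by (intro inR) blast
      have "?v \<notin> ?E"
      proof
        assume "?v \<in> ?E"
        then obtain f where f: "Poly_Mapping.keys f \<subseteq> B'" "?v = \<phi> f" by blast
        let ?g = "Poly_Mapping.single m 1 - f"
        have "\<forall>p\<in>Z. eval_poly_at p ?g = 0"
          using f(2) \<phi>_eq[OF m sub[OF f(1)]] by (simp add: eval_poly_at_diff)
        moreover have "Poly_Mapping.keys ?g \<subseteq> B"
          using f(1) insert.prems Poly_Mapping.keys_diff[of "Poly_Mapping.single m 1" f] by auto
        ultimately have "?g = 0" using indep by blast
        then have "f = Poly_Mapping.single m 1" by simp
        then show False using f(1) insert.hyps by simp
      qed
      moreover have "h.S.line_extension K ?v ?E = \<phi> ` {f. Poly_Mapping.keys f \<subseteq> insert m B'}"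
      proof (rule subset_antisym; rule subsetI)
        have comb: "\<phi> (Poly_Mapping.single 0 c) \<otimes>\<^bsub>?Q\<^esub> ?v \<oplus>\<^bsub>?Q\<^esub> \<phi> f = \<phi> (Poly_Mapping.single m c + f)"
          if "Poly_Mapping.keys f \<subseteq> B'" for c f
        proof -
          have c: "Poly_Mapping.single 0 c \<in> carrier ?R" by (simp add: polys_in_single)
          have "\<phi> (Poly_Mapping.single 0 c) \<otimes>\<^bsub>?Q\<^esub> ?v = \<phi> (Poly_Mapping.single m c)"
            using h.hom_mult[OF c m[of 1]] by (simp add: mult_single)
          then show ?thesis using h.hom_add[OF m[of c] sub[OF that]] by simp
        qed
        {
          fix x assume "x \<in> h.S.line_extension K ?v ?E"
          then obtain c f where f: "Poly_Mapping.keys f \<subseteq> B'"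
            and x: "x = \<phi> (Poly_Mapping.single 0 c) \<otimes>\<^bsub>?Q\<^esub> ?v \<oplus>\<^bsub>?Q\<^esub> \<phi> f"
            unfolding h.S.line_extension_mem_iff K by auto
          have "Poly_Mapping.keys (Poly_Mapping.single m c + f) \<subseteq> insert m B'"
            using f Poly_Mapping.keys_add[of "Poly_Mapping.single m c" f] by (auto split: if_splits)
          then show "x \<in> \<phi> ` {f. Poly_Mapping.keys f \<subseteq> insert m B'}"
            unfolding x comb[OF f] by blast
        next
          fix x assume "x \<in> \<phi> ` {f. Poly_Mapping.keys f \<subseteq> insert m B'}"
          then obtain g where g: "Poly_Mapping.keys g \<subseteq> insert m B'" "x = \<phi> g" by blast
          let ?c = "Poly_Mapping.lookup g m"
          let ?f = "g - Poly_Mapping.single m ?c"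
          have f: "Poly_Mapping.keys ?f \<subseteq> B'"
            using g(1) by (auto simp: in_keys_iff lookup_minus lookup_single when_def split: if_splits)
          have "x = \<phi> (Poly_Mapping.single 0 ?c) \<otimes>\<^bsub>?Q\<^esub> ?v \<oplus>\<^bsub>?Q\<^esub> \<phi> ?f"
            unfolding comb[OF f] g(2) by simp
          then show "x \<in> h.S.line_extension K ?v ?E"
            unfolding h.S.line_extension_mem_iff K using f by blast
        }
      qed
      ultimately show ?case
        using h.S.dimension.Suc_dim[of ?v ?E "card B'" K] insert m h.hom_closed by simp
    qed
  qed
  have piece: "quot_graded_piece V ?I k = \<phi> ` {f. Poly_Mapping.keys f \<subseteq> B}"
  proof (rule subset_antisym; rule subsetI)
    fix x assume "x \<in> quot_graded_piece V ?I k"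
    then obtain f where f: "f \<in> forms V k" "x = \<phi> f"
      unfolding quot_graded_piece_def \<phi>_def by blast
    then obtain g where g: "Poly_Mapping.keys g \<subseteq> B" "\<forall>p\<in>Z. eval_poly_at p f = eval_poly_at p g"
      using span by blast
    have "f \<in> carrier ?R" using f(1) unfolding forms_def by simp
    then have "x = \<phi> g" using \<phi>_eq[of f g] inR[OF g(1)] g(2) f(2) by simp
    then show "x \<in> \<phi> ` {f. Poly_Mapping.keys f \<subseteq> B}" using g(1) by blast
  next
    fix x assume "x \<in> \<phi> ` {f. Poly_Mapping.keys f \<subseteq> B}"
    then obtain f where f: "Poly_Mapping.keys f \<subseteq> B" "x = \<phi> f" by blast
    then have "f \<in> forms V k" using inR[OF f(1)] B unfolding forms_def by blast
    then show "x \<in> quot_graded_piece V ?I k"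
      unfolding quot_graded_piece_def using f(2) \<phi>_def by blast
  qed
  show ?thesis
    unfolding hilbert_function_def piece K_def[symmetric] h.S.dim_def over_def
    using dimension[OF subset_refl] h.S.dimension_is_inj[OF field _ dimension[OF subset_refl]]
    by (intro the_equality)
qed

lemma binomial_poly: "\<exists>P :: rat poly. \<forall>k::nat. poly P (of_nat k) = of_nat (k choose r)"
proof -
  let ?P = "smult (1 / fact r) (\<Prod>i = 0..<r. [:- of_nat i, 1:]) :: rat poly"
  have "poly ?P (of_nat k) = of_nat (k choose r)" for k
    unfolding binomial_gbinomial gbinomial_prod_rev by (simp add: poly_prod)
  then show ?thesis by blast
qed

text \<open>A polynomial is determined by its values at all large natural numbers.\<close>

lemma hilbertianI:
  fixes P :: "rat poly"
  assumes "\<And>k. of_nat (hilbert_function V I k) = poly P (of_nat k)"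
  shows "hilbertian V I"
proof -
  have "hilbert_polynomial V I = P"
    unfolding hilbert_polynomial_def
  proof (rule the_equality)
    show "\<forall>\<^sub>F k in sequentially. of_nat (hilbert_function V I k) = poly P (of_nat k)"
      using assms by simp
    fix P' :: "rat poly"
    assume "\<forall>\<^sub>F k in sequentially. of_nat (hilbert_function V I k) = poly P' (of_nat k)"
    then obtain N where N: "\<And>k. N \<le> k \<Longrightarrow> poly P' (of_nat k) = poly P (of_nat k)"
      using assms unfolding eventually_sequentially by metis
    show "P' = P"
    proof (rule ccontr)
      assume "P' \<noteq> P"
      then have "finite {x. poly (P' - P) x = 0}" by (intro poly_roots_finite) simp
      moreover have "of_nat ` {N..} \<subseteq> {x. poly (P' - P) x = 0}" using N by auto
      ultimately have "finite (of_nat ` {N..} :: rat set)" using finite_subset by blast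
      then have "finite {N..}" by (rule finite_imageD) (simp add: inj_on_def)
      then show False by (simp add: infinite_Ici)
    qed
  qed
  then show ?thesis using assms unfolding hilbertian_def by simp
qed

section \<open>The basis of standard monomials\<close>

definition standard_monomials :: "nat \<Rightarrow> (nat \<Rightarrow> nat) \<Rightarrow> nat \<Rightarrow> (nat \<times> nat) monomial set" where
  "standard_monomials n w k = {m. Poly_Mapping.keys m \<subseteq> mat_vars n \<and> total_degree m = k
    \<and> standard w (Poly_Mapping.keys m)}"

lemma finite_mat_vars [simp]: "finite (mat_vars n)"
  by (simp add: mat_vars_def)

lemma finite_standard_monomials: "finite (standard_monomials n w k)"
  by (rule finite_subset[OF _ finite_monomials_of_degree[OF finite_mat_vars, of n k]])
    (auto simp: standard_monomials_def)

text \<open>To rewrite a polynomial modulo the functions that vanish on \<open>Z\<close>, it suffices to rewrite its monomials.\<close>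

lemma substitute_monomials:
  assumes "\<And>m. m \<in> Poly_Mapping.keys f \<Longrightarrow> \<exists>g. Poly_Mapping.keys g \<subseteq> B \<and>
    (\<forall>p\<in>Z. eval_monomial p m = eval_poly_at p g)"
  shows "\<exists>g. Poly_Mapping.keys g \<subseteq> B \<and> (\<forall>p\<in>Z. eval_poly_at p f = eval_poly_at p g)"
proof -
  obtain g where g: "\<And>m. m \<in> Poly_Mapping.keys f \<Longrightarrow> Poly_Mapping.keys (g m) \<subseteq> B \<and>
      (\<forall>p\<in>Z. eval_monomial p m = eval_poly_at p (g m))"
    using assms by metis
  define h where "h = (\<Sum>m\<in>Poly_Mapping.keys f. \<Sum>m'\<in>Poly_Mapping.keys (g m).
    Poly_Mapping.single m' (Poly_Mapping.lookup f m * Poly_Mapping.lookup (g m) m'))"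
  have "Poly_Mapping.lookup h m' = 0" if "m' \<notin> B" for m'
    unfolding h_def lookup_sum lookup_single when_def
    using g that by (intro sum.neutral ballI) auto
  then have "Poly_Mapping.keys h \<subseteq> B" by (auto simp: in_keys_iff)
  moreover have "eval_poly_at p f = eval_poly_at p h" if "p \<in> Z" for p
  proof -
    have "eval_poly_at p f = (\<Sum>m\<in>Poly_Mapping.keys f. Poly_Mapping.lookup f m * eval_poly_at p (g m))"
      unfolding eval_poly_at_def[of p f] by (rule sum.cong) (use g that in auto)
    also have "\<dots> = eval_poly_at p h"
      unfolding h_def eval_poly_at_sum eval_poly_at_single eval_poly_at_def[of p "g _"]
      by (simp add: sum_distrib_left mult.assoc)
    finally show ?thesis .
  qed
  ultimately show ?thesis by blast
qed

text \<open>Straightening ends because each step goes up in the finite set of monomials of degree \<open>k\<close>.\<close>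

lemma standard_monomials_span_monomial:
  assumes "Poly_Mapping.keys m \<subseteq> mat_vars n" "total_degree m = k"
  shows "\<exists>g. Poly_Mapping.keys g \<subseteq> standard_monomials n w k \<and>
    (\<forall>p\<in>orbit_points w. eval_monomial p m = eval_poly_at p g)"
  using assms
proof (induction "card {m'. Poly_Mapping.keys m' \<subseteq> mat_vars n \<and> total_degree m' = k \<and> m < m'}"
    arbitrary: m rule: less_induct)
  case (less m)
  let ?above = "\<lambda>m. {m'. Poly_Mapping.keys m' \<subseteq> mat_vars n \<and> total_degree m' = k \<and> m < m'}"
  show ?case
  proof (cases "standard w (Poly_Mapping.keys m)")
    case True
    then show ?thesis
      using less.prems by (intro exI[of _ "Poly_Mapping.single m 1"]) (auto simp: standard_monomials_def)
  next
    case False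
    obtain q where q: "\<And>m'. m' \<in> Poly_Mapping.keys q \<Longrightarrow> m < m' \<and> total_degree m' = k
          \<and> Poly_Mapping.keys m' \<subseteq> mat_vars n"
        "\<And>p. p \<in> orbit_points w \<Longrightarrow> eval_monomial p m = eval_poly_at p q"
      using nonstandard_monomial_reduces[OF less.prems(1) False] less.prems(2) by metis
    have "\<exists>g. Poly_Mapping.keys g \<subseteq> standard_monomials n w k \<and>
      (\<forall>p\<in>orbit_points w. eval_monomial p m' = eval_poly_at p g)"
      if m': "m' \<in> Poly_Mapping.keys q" for m'
    proof (rule less.hyps)
      have "?above m' \<subset> ?above m"
        using q(1)[OF m'] by (auto intro: less_trans)
      moreover have "finite (?above m)"
        by (rule finite_subset[OF _ finite_monomials_of_degree[OF finite_mat_vars, of n k]]) auto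
      ultimately show "card (?above m') < card (?above m)" by (rule psubset_card_mono[rotated])
    qed (use q(1)[OF m'] in auto)
    from substitute_monomials[OF this] show ?thesis using q(2) by metis
  qed
qed

lemma standard_monomials_span:
  assumes "f \<in> forms (mat_vars n) k"
  shows "\<exists>g. Poly_Mapping.keys g \<subseteq> standard_monomials n w k \<and>
    (\<forall>p\<in>orbit_points w. eval_poly_at p f = eval_poly_at p g)"
  by (rule substitute_monomials, rule standard_monomials_span_monomial)
    (use assms in \<open>auto simp: forms_def polys_in_def\<close>)

lemma standard_monomials_independent:
  assumes w: "bij w" and f: "Poly_Mapping.keys f \<subseteq> standard_monomials n w k"
    and van: "\<forall>p\<in>orbit_points w. eval_poly_at p f = 0"
  shows "f = 0"
proof (rule ccontr)
  assume "f \<noteq> 0"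
  let ?S = "Poly_Mapping.keys f"
  have ne: "?S \<noteq> {}" using \<open>f \<noteq> 0\<close> by simp
  have lead: "Min ?S \<in> ?S" using ne by simp
  have "\<exists>p\<in>orbit_points w. eval_sum (Poly_Mapping.lookup f) ?S p \<noteq> 0"
  proof (rule standard_leading_nonvanishing[OF w _ ne])
    show "\<forall>m\<in>?S. Poly_Mapping.keys m \<subseteq> mat_vars n"
      using f unfolding standard_monomials_def by blast
    show "standard w (Poly_Mapping.keys (Min ?S))"
      using f lead unfolding standard_monomials_def by blast
    show "Poly_Mapping.lookup f (Min ?S) \<noteq> 0" using lead by (simp add: in_keys_iff)
  qed simp
  then show False using van unfolding eval_sum_def eval_poly_at_def by simp
qed

text \<open>No dot and no element of a chain lies above row \<open>0\<close>, so in a chain that contains \<open>(0, w 0)\<close> all other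
  elements lie strictly to the left of column \<open>w 0\<close>. The rank of the part of the corner to the left of this column
  is smaller by at least one, since the dot \<open>(0, w 0)\<close> is lost.\<close>

lemma cone_point:
  assumes w: "bij w"
  shows "standard w (insert (0, w 0) D) \<longleftrightarrow> standard w D"
proof
  assume "standard w (insert (0, w 0) D)"
  then show "standard w D" by (rule standard_subset) auto
next
  assume D: "standard w D"
  show "standard w (insert (0, w 0) D)"
    unfolding standard_def
  proof (intro allI impI)
    fix A a b
    assume A: "A \<subseteq> insert (0, w 0) D" "antidiagonal A" "A \<subseteq> {..a} \<times> {..b}"
    have fin: "finite A" using A(3) finite_subset by blast
    show "card A \<le> nw_rank w a b"
    proof (cases "(0, w 0) \<in> A")
      case False
      then show ?thesis using standardD[OF D _ A(2,3)] A(1) by blast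
    next
      case True
      let ?A = "A - {(0, w 0)}"
      let ?S = "{s. s \<le> a \<and> w s \<le> b}"
      have wb: "w 0 \<le> b" using True A(3) by auto
      have left: "snd p < w 0" if "p \<in> ?A" for p
        using A(2) True that unfolding antidiagonal_def by fastforce
      have "card ?A \<le> card (?S - {0})"
      proof (cases "?A = {}")
        case True
        then show ?thesis by (metis card.empty zero_le)
      next
        case False
        then have pos: "0 < w 0" using left by fastforce
        have sub: "?A \<subseteq> {..a} \<times> {..w 0 - 1}" using left A(3) pos by fastforce
        have "card ?A \<le> nw_rank w a (w 0 - 1)"
          by (rule standardD[OF D _ antidiagonal_subset[OF A(2)] sub]) (use A(1) in auto)
        also have "\<dots> \<le> card (?S - {0})"
          unfolding nw_rank_def by (rule card_mono) (use wb pos in \<open>auto intro: le_trans\<close>)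
        finally show ?thesis .
      qed
      moreover have "card (?S - {0}) = card ?S - 1" "card ?S \<noteq> 0"
        using wb by auto
      moreover have "card ?A = card A - 1" using True by simp
      ultimately show ?thesis unfolding nw_rank_def by linarith
    qed
  qed
qed

text \<open>Splitting off the exponent of one element of \<open>F\<close> turns the count into the hockey-stick sum
  \<open>\<Sum>i<k. i choose card F\<close>.\<close>

lemma card_cone_monomials:
  fixes v0 :: 'v
  assumes "finite F" "v0 \<notin> F"
  shows "card {m. F \<subseteq> Poly_Mapping.keys m \<and> Poly_Mapping.keys m \<subseteq> insert v0 F \<and> total_degree m = k}
    = k choose card F"
  using assms
proof (induction F arbitrary: k)
  case empty
  have "{m. {} \<subseteq> Poly_Mapping.keys m \<and> Poly_Mapping.keys m \<subseteq> {v0} \<and> total_degree m = k}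
      = {Poly_Mapping.single v0 k}"
  proof (rule subset_antisym; rule subsetI)
    fix m assume "m \<in> {m. {} \<subseteq> Poly_Mapping.keys m \<and> Poly_Mapping.keys m \<subseteq> {v0} \<and> total_degree m = k}"
    then have m: "Poly_Mapping.keys m \<subseteq> {v0}" "total_degree m = k" by auto
    then have "Poly_Mapping.lookup m v0 = k" using total_degree_superset[OF _ m(1)] by simp
    then have "m = Poly_Mapping.single v0 k"
      using m(1) by (intro poly_mapping_eqI) (auto simp: lookup_single when_def in_keys_iff)
    then show "m \<in> {Poly_Mapping.single v0 k}" by simp
  qed auto
  then show ?case by simp
next
  case (insert x F)
  let ?M = "\<lambda>F k. {m. F \<subseteq> Poly_Mapping.keys m \<and> Poly_Mapping.keys m \<subseteq> insert v0 F \<and> total_degree m = k}"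
  let ?f = "\<lambda>i m. m + Poly_Mapping.single x (k - i)"
  have x: "x \<noteq> v0" "x \<notin> F" "v0 \<notin> F" using insert by auto
  have finM: "finite (?M F i)" for i
    by (rule finite_subset[OF _ finite_monomials_of_degree[of "insert v0 F" i]])
      (use insert.hyps in auto)
  have look: "Poly_Mapping.lookup (?f i m) x = k - i" if "m \<in> ?M F i" for i m
  proof -
    have "Poly_Mapping.lookup m x = 0" using that x by (auto simp: in_keys_iff)
    then show ?thesis by (simp add: lookup_add)
  qed
  have "?M (insert x F) k = (\<Union>i<k. ?f i ` ?M F i)"
  proof (rule subset_antisym; rule subsetI)
    fix m assume m: "m \<in> ?M (insert x F) k"
    let ?e = "Poly_Mapping.lookup m x"
    let ?m = "m - Poly_Mapping.single x ?e"
    have split: "m = ?m + Poly_Mapping.single x ?e"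
      by (rule poly_mapping_eqI) (auto simp: lookup_add lookup_minus lookup_single when_def)
    have e: "?e \<noteq> 0" using m by (auto simp: in_keys_iff)
    have deg: "k = total_degree ?m + ?e"
      using m arg_cong[OF split, of total_degree] by (simp add: total_degree_add)
    have "Poly_Mapping.keys ?m = Poly_Mapping.keys m - {x}"
      by (auto simp: in_keys_iff lookup_minus lookup_single when_def split: if_splits)
    then have "?m \<in> ?M F (k - ?e)" using m x deg by auto
    moreover have "m = ?f (k - ?e) ?m" using split deg by simp
    ultimately have "m \<in> ?f (k - ?e) ` ?M F (k - ?e)" by (rule image_eqI[rotated])
    moreover have "k - ?e < k" using e deg by linarith
    ultimately show "m \<in> (\<Union>i<k. ?f i ` ?M F i)" by blast
  next
    fix m assume "m \<in> (\<Union>i<k. ?f i ` ?M F i)"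
    then obtain i m' where "i < k" "m' \<in> ?M F i" "m = ?f i m'" by blast
    then show "m \<in> ?M (insert x F) k"
      by (auto simp: keys_add_nat total_degree_add)
  qed
  moreover have "card (\<Union>i<k. ?f i ` ?M F i) = (\<Sum>i<k. card (?f i ` ?M F i))"
  proof (rule card_UN_disjoint)
    show "\<forall>i\<in>{..<k}. \<forall>j\<in>{..<k}. i \<noteq> j \<longrightarrow> ?f i ` ?M F i \<inter> ?f j ` ?M F j = {}"
    proof (intro ballI impI)
      fix i j assume ij: "i \<in> {..<k}" "j \<in> {..<k}" "i \<noteq> j"
      {
        fix m assume "m \<in> ?f i ` ?M F i" "m \<in> ?f j ` ?M F j"
        then have "Poly_Mapping.lookup m x = k - i" "Poly_Mapping.lookup m x = k - j"
          using look by auto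
        then have False using ij by simp
      }
      then show "?f i ` ?M F i \<inter> ?f j ` ?M F j = {}" by blast
    qed
  qed (use finM in auto)
  moreover have "card (?f i ` ?M F i) = i choose card F" for i
    using insert.IH[of i] x by (subst card_image) (auto simp: inj_on_def)
  moreover have "(\<Sum>i<k. i choose card F) = k choose Suc (card F)"
  proof (cases k)
    case (Suc j)
    then show ?thesis using sum_choose_upper[of "card F" j] by (simp add: lessThan_Suc_atMost)
  qed simp
  ultimately show ?case using insert.hyps by simp
qed

text \<open>Standard monomials are sorted by their support away from the apex \<open>(0, w 0)\<close>.\<close>

lemma card_standard_monomials:
  assumes w: "bij w" and n: "(0, w 0) \<in> mat_vars n"
  shows "card (standard_monomials n w k) =
    (\<Sum>F\<in>{F. F \<subseteq> mat_vars n - {(0, w 0)} \<and> standard w F}. k choose card F)"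
proof -
  let ?v = "(0, w 0)"
  let ?\<F> = "{F. F \<subseteq> mat_vars n - {?v} \<and> standard w F}"
  let ?M = "\<lambda>F. {m. F \<subseteq> Poly_Mapping.keys m \<and> Poly_Mapping.keys m \<subseteq> insert ?v F \<and> total_degree m = k}"
  have union: "standard_monomials n w k = (\<Union>F\<in>?\<F>. ?M F)"
  proof (rule subset_antisym; rule subsetI)
    fix m assume m: "m \<in> standard_monomials n w k"
    let ?F = "Poly_Mapping.keys m - {?v}"
    have "?F \<in> ?\<F>"
      using m standard_subset[of w "Poly_Mapping.keys m" ?F] unfolding standard_monomials_def by auto
    moreover have "m \<in> ?M ?F" using m unfolding standard_monomials_def by auto
    ultimately show "m \<in> (\<Union>F\<in>?\<F>. ?M F)" by blast
  next
    fix m assume "m \<in> (\<Union>F\<in>?\<F>. ?M F)"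
    then obtain F where F: "F \<subseteq> mat_vars n" "standard w F" and m: "m \<in> ?M F" by auto
    have "standard w (Poly_Mapping.keys m)"
      by (rule standard_subset[of w "insert ?v F"]) (use F m cone_point[OF w] in auto)
    then show "m \<in> standard_monomials n w k"
      using F m n unfolding standard_monomials_def by auto
  qed
  have "card (standard_monomials n w k) = (\<Sum>F\<in>?\<F>. card (?M F))"
    unfolding union
  proof (rule card_UN_disjoint)
    show "finite ?\<F>" by (rule finite_subset[of _ "Pow (mat_vars n)"]) auto
    show "\<forall>F\<in>?\<F>. finite (?M F)"
    proof
      fix F assume "F \<in> ?\<F>"
      then show "finite (?M F)"
        by (intro finite_subset[OF _ finite_monomials_of_degree[OF finite_mat_vars, of n k]])
          (use n in auto)
    qed
    have M: "F = Poly_Mapping.keys m - {?v}" if "F \<in> ?\<F>" "m \<in> ?M F" for F m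
      using that by auto
    show "\<forall>F\<in>?\<F>. \<forall>G\<in>?\<F>. F \<noteq> G \<longrightarrow> ?M F \<inter> ?M G = {}"
    proof (intro ballI impI)
      fix F G assume FG: "F \<in> ?\<F>" "G \<in> ?\<F>" "F \<noteq> G"
      have "m \<notin> ?M G" if "m \<in> ?M F" for m
      proof
        assume "m \<in> ?M G"
        from M[OF FG(1) that] M[OF FG(2) this] have "F = G" by (rule trans[OF _ sym])
        then show False using FG(3) by contradiction
      qed
      then show "?M F \<inter> ?M G = {}" unfolding disjoint_iff by (rule allI[OF impI])
    qed
  qed
  also have "\<dots> = (\<Sum>F\<in>?\<F>. k choose card F)"
  proof (rule sum.cong[OF refl])
    fix F assume "F \<in> ?\<F>"
    then have "finite F" "?v \<notin> F" using finite_subset[OF _ finite_mat_vars, of F n] by auto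
    then show "card (?M F) = k choose card F" by (rule card_cone_monomials)
  qed
  finally show ?thesis .
qed

section \<open>Orbits of permutation matrices\<close>

text \<open>Back substitution: comparing the entries of \<open>A * B\<close> in row \<open>i\<close>, from the last row upwards, leaves only
  the summand with the diagonal entry of \<open>A\<close>.\<close>

lemma upper_triangular_inverse:
  fixes A B :: "'a :: field mat"
  assumes A: "A \<in> carrier_mat n n" and B: "B \<in> carrier_mat n n"
    and tri: "upper_triangular A" and AB: "A * B = 1\<^sub>m n"
  shows "upper_triangular B" and "\<And>i. i < n \<Longrightarrow> A $$ (i, i) \<noteq> 0"
proof -
  have row: "A $$ (i, i) \<noteq> 0 \<and> (\<forall>j<i. B $$ (i, j) = 0)" if "i < n" for i
    using that
  proof (induction "n - i" arbitrary: i rule: less_induct)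
    case (less i)
    have entry: "A $$ (i, i) * B $$ (i, j) = (if i = j then 1 else 0)" if "j \<le> i" for j
    proof -
      have "(A * B) $$ (i, j) = (\<Sum>k = 0..<n. A $$ (i, k) * B $$ (k, j))"
        using A B less.prems that by (simp add: scalar_prod_def)
      also have "\<dots> = (\<Sum>k\<in>{i}. A $$ (i, k) * B $$ (k, j))"
      proof (rule sum.mono_neutral_right)
        show "\<forall>k\<in>{0..<n} - {i}. A $$ (i, k) * B $$ (k, j) = 0"
        proof
          fix k assume k: "k \<in> {0..<n} - {i}"
          show "A $$ (i, k) * B $$ (k, j) = 0"
          proof (cases "k < i")
            case True
            then have "A $$ (i, k) = 0" using tri A less.prems by (intro upper_triangularD) auto
            then show ?thesis by simp
          next
            case False
            then have "n - k < n - i" "k < n" "j < k" using k that less.prems by auto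
            then have "B $$ (k, j) = 0" using less.hyps by blast
            then show ?thesis by simp
          qed
        qed
      qed (use less.prems in auto)
      finally show ?thesis using less.prems that AB by simp
    qed
    have "A $$ (i, i) * B $$ (i, i) = 1" using entry[of i] by simp
    then have nz: "A $$ (i, i) \<noteq> 0" by auto
    moreover have "B $$ (i, j) = 0" if "j < i" for j using entry[of j] that nz by simp
    ultimately show ?case by blast
  qed
  show "upper_triangular B" using row B by (intro upper_triangularI) auto
  show "A $$ (i, i) \<noteq> 0" if "i < n" for i using row that by auto
qed

lemma GL_D:
  assumes "A \<in> GL n"
  shows "A \<in> carrier_mat n n" "inv\<^bsub>mat_ring n\<^esub> A \<in> GL n"
    "A * inv\<^bsub>mat_ring n\<^esub> A = 1\<^sub>m n" "inv\<^bsub>mat_ring n\<^esub> A * A = 1\<^sub>m n"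
    "inv\<^bsub>mat_ring n\<^esub> (inv\<^bsub>mat_ring n\<^esub> A) = A"
proof -
  interpret ring "mat_ring n" by (rule ring_mat)
  have A: "A \<in> Units (mat_ring n)" using assms unfolding GL_def .
  show "A \<in> carrier_mat n n" using Units_closed[OF A] by (simp add: ring_mat_simps)
  show "inv\<^bsub>mat_ring n\<^esub> A \<in> GL n" using Units_inv_Units[OF A] unfolding GL_def .
  show "A * inv\<^bsub>mat_ring n\<^esub> A = 1\<^sub>m n" using Units_r_inv[OF A] by (simp add: ring_mat_simps)
  show "inv\<^bsub>mat_ring n\<^esub> A * A = 1\<^sub>m n" using Units_l_inv[OF A] by (simp add: ring_mat_simps)
  show "inv\<^bsub>mat_ring n\<^esub> (inv\<^bsub>mat_ring n\<^esub> A) = A" by (rule Units_inv_inv[OF A])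
qed

lemma upper_triangular_GL:
  assumes A: "A \<in> carrier_mat n n" and tri: "upper_triangular A"
    and diag: "\<And>i. i < n \<Longrightarrow> A $$ (i, i) \<noteq> 0"
  shows "A \<in> GL n"
proof -
  have "0 \<notin> set (diag_mat A)" using A diag unfolding diag_mat_def by auto
  then have "det A \<noteq> 0" using upper_triangular_imp_det_eq_0_iff[OF A tri] by simp
  then show ?thesis unfolding GL_def by (rule det_non_zero_imp_unit[OF A])
qed

lemma Borel_inverse:
  assumes "A \<in> Borel n"
  shows "inv\<^bsub>mat_ring n\<^esub> A \<in> Borel n"
  using assms upper_triangular_inverse(1)[of A n "inv\<^bsub>mat_ring n\<^esub> A"] GL_D[of A n]
    GL_D(1)[of "inv\<^bsub>mat_ring n\<^esub> A" n]
  unfolding Borel_def by simp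

lemma Borel_diag:
  assumes "A \<in> Borel n" "i < n"
  shows "A $$ (i, i) \<noteq> 0"
  using assms upper_triangular_inverse(2)[of A n "inv\<^bsub>mat_ring n\<^esub> A"] GL_D[of A n]
    GL_D(1)[of "inv\<^bsub>mat_ring n\<^esub> A" n]
  unfolding Borel_def by simp

lemma Borel_opp_transpose:
  assumes "A \<in> Borel_opp n"
  shows "transpose_mat A \<in> Borel n"
proof -
  let ?B = "inv\<^bsub>mat_ring n\<^esub> A"
  have A: "A \<in> GL n" and tri: "upper_triangular (transpose_mat A)" using assms unfolding Borel_opp_def by auto
  have carr: "A \<in> carrier_mat n n" "?B \<in> carrier_mat n n"
    using GL_D(1)[OF A] GL_D(1)[OF GL_D(2)[OF A]] .
  have "transpose_mat A * transpose_mat ?B = transpose_mat (?B * A)"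
    by (rule transpose_mult[OF carr(2,1), symmetric])
  also have "\<dots> = 1\<^sub>m n" using GL_D(4)[OF A] by simp
  finally have inv: "transpose_mat A * transpose_mat ?B = 1\<^sub>m n" .
  have "transpose_mat A $$ (i, i) \<noteq> 0" if "i < n" for i
    using upper_triangular_inverse(2)[OF _ _ tri inv that] carr by simp
  then have "transpose_mat A \<in> GL n" using carr tri by (intro upper_triangular_GL) auto
  then show ?thesis using tri unfolding Borel_def by simp
qed

lemma perm_product_entry:
  assumes L: "L \<in> carrier_mat n n" and U: "U \<in> carrier_mat n n" and w: "w permutes {..<n}"
    and xy: "x < n" "y < n"
  shows "(L * perm_matrix n w * U) $$ (x, y) = (\<Sum>s<n. L $$ (x, s) * U $$ (w s, y))"
proof -
  let ?P = "perm_matrix n w"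
  have P: "?P \<in> carrier_mat n n" unfolding perm_matrix_def by simp
  have PU: "(?P * U) $$ (s, y) = U $$ (w s, y)" if s: "s < n" for s
  proof -
    have ws: "w s < n" using permutes_in_image[OF w, of s] s by simp
    have "(?P * U) $$ (s, y) = (\<Sum>t = 0..<n. ?P $$ (s, t) * U $$ (t, y))"
      using P U s xy by (simp add: scalar_prod_def)
    also have "\<dots> = (\<Sum>t\<in>{w s}. ?P $$ (s, t) * U $$ (t, y))"
      by (rule sum.mono_neutral_right) (use ws s in \<open>auto simp: perm_matrix_def\<close>)
    also have "\<dots> = U $$ (w s, y)" using ws s by (simp add: perm_matrix_def)
    finally show ?thesis .
  qed
  have "L * ?P * U = L * (?P * U)" by (rule assoc_mult_mat[OF L P U])
  moreover have "(L * (?P * U)) $$ (x, y) = (\<Sum>s = 0..<n. L $$ (x, s) * (?P * U) $$ (s, y))"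
    using L P U xy by (simp add: scalar_prod_def)
  ultimately show ?thesis using PU by (simp add: atLeast0LessThan)
qed

lemma orbit_point_sum_below:
  assumes "lower l" "x < n"
  shows "orbit_point w l u (x, y) = (\<Sum>s<n. l x s * u (w s) y)"
proof -
  have "{..n - 1} = {..<n}" using assms(2) by auto
  then show ?thesis using orbit_point_extend[OF assms(1), of x "n - 1"] assms(2) by simp
qed

lemma orbit_to_point:
  assumes w: "w permutes {..<n}" and M: "M \<in> orbit n (perm_matrix n w)"
  shows "\<exists>p\<in>orbit_points w. \<forall>v\<in>mat_vars n. p v = M $$ v"
proof -
  obtain L b where L: "L \<in> Borel_opp n" and b: "b \<in> Borel n"
    and M: "M = L * perm_matrix n w * inv\<^bsub>mat_ring n\<^esub> b"
    using M unfolding orbit_def by blast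
  define U where "U = inv\<^bsub>mat_ring n\<^esub> b"
  have U: "U \<in> Borel n" unfolding U_def by (rule Borel_inverse[OF b])
  have LT: "transpose_mat L \<in> Borel n" by (rule Borel_opp_transpose[OF L])
  have carr: "L \<in> carrier_mat n n" "U \<in> carrier_mat n n"
    using L U GL_D(1) unfolding Borel_opp_def Borel_def by auto
  define l where "l x s = (if x < n \<and> s < n then L $$ (x, s) else if x = s then 1 else 0)" for x s
  define u where "u r y = (if r < n \<and> y < n then U $$ (r, y) else if r = y then 1 else 0)" for r y
  have l: "lower l" unfolding lower_def
  proof (intro conjI allI impI)
    fix x s :: nat assume "x < s"
    moreover have "transpose_mat L $$ (s, x) = 0" if "s < n"
      using LT carr that \<open>x < s\<close> unfolding Borel_def by (intro upper_triangularD) auto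
    ultimately show "l x s = 0" using carr unfolding l_def by auto
  next
    fix x show "l x x \<noteq> 0" using Borel_diag[OF LT, of x] carr unfolding l_def by auto
  qed
  have u: "upper u" unfolding upper_def
  proof (intro conjI allI impI)
    fix r y :: nat assume "y < r"
    moreover have "U $$ (r, y) = 0" if "r < n"
      using U carr that \<open>y < r\<close> unfolding Borel_def by (intro upper_triangularD) auto
    ultimately show "u r y = 0" unfolding u_def by auto
  next
    fix y show "u y y \<noteq> 0" using Borel_diag[OF U, of y] unfolding u_def by auto
  qed
  have "orbit_point w l u v = M $$ v" if vn: "v \<in> mat_vars n" for v
  proof -
    obtain x y where v: "v = (x, y)" "x < n" "y < n" using vn by (auto simp: mat_vars_def)
    have "w s < n" if "s < n" for s using permutes_in_image[OF w, of s] that by simp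
    then have "(\<Sum>s<n. l x s * u (w s) y) = (\<Sum>s<n. L $$ (x, s) * U $$ (w s, y))"
      using v by (intro sum.cong) (auto simp: l_def u_def)
    then show ?thesis
      unfolding v(1) orbit_point_sum_below[OF l v(2)] M U_def[symmetric]
        perm_product_entry[OF carr w v(2,3)] .
  qed
  then show ?thesis using l u unfolding orbit_points_def by blast
qed

lemma point_to_orbit:
  assumes w: "w permutes {..<n}" and p: "p \<in> orbit_points w"
  shows "\<exists>M\<in>orbit n (perm_matrix n w). \<forall>v\<in>mat_vars n. p v = M $$ v"
proof -
  obtain l u where l: "lower l" and u: "upper u" and p: "p = orbit_point w l u"
    using p unfolding orbit_points_def by auto
  define L where "L = mat n n (\<lambda>(x, s). l x s)"
  define U where "U = mat n n (\<lambda>(r, y). u r y)"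
  have carr: "L \<in> carrier_mat n n" "U \<in> carrier_mat n n" unfolding L_def U_def by auto
  have U: "U \<in> Borel n"
  proof -
    have "upper_triangular U" using u unfolding U_def upper_def by auto
    moreover have "U $$ (i, i) \<noteq> 0" if "i < n" for i using u that unfolding U_def upper_def by auto
    ultimately show ?thesis using upper_triangular_GL[OF carr(2)] unfolding Borel_def by blast
  qed
  have L: "L \<in> Borel_opp n"
  proof -
    have tri: "upper_triangular (transpose_mat L)" using l unfolding L_def lower_def by auto
    have "transpose_mat L $$ (i, i) \<noteq> 0" if "i < n" for i using l that unfolding L_def lower_def by auto
    then have "0 \<notin> set (diag_mat (transpose_mat L))" using carr unfolding diag_mat_def by auto
    then have "det (transpose_mat L) \<noteq> 0"
      using upper_triangular_imp_det_eq_0_iff[OF transpose_carrier_mat[THEN iffD2, OF carr(1)] tri] by simp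
    then have "det L \<noteq> 0" using det_transpose[OF carr(1)] by simp
    then have "L \<in> GL n" unfolding GL_def by (rule det_non_zero_imp_unit[OF carr(1)])
    then show ?thesis using tri unfolding Borel_opp_def by simp
  qed
  let ?M = "L * perm_matrix n w * U"
  have "U = inv\<^bsub>mat_ring n\<^esub> (inv\<^bsub>mat_ring n\<^esub> U)" using U GL_D(5)[of U n] unfolding Borel_def by simp
  then have "?M = L * perm_matrix n w * inv\<^bsub>mat_ring n\<^esub> (inv\<^bsub>mat_ring n\<^esub> U)" by simp
  then have M: "?M \<in> orbit n (perm_matrix n w)"
    unfolding orbit_def mem_Collect_eq using L Borel_inverse[OF U] by (intro exI conjI)
  have "p v = ?M $$ v" if vn: "v \<in> mat_vars n" for v
  proof -
    obtain x y where v: "v = (x, y)" "x < n" "y < n" using vn by (auto simp: mat_vars_def)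
    have "w s < n" if "s < n" for s using permutes_in_image[OF w, of s] that by simp
    then have "(\<Sum>s<n. l x s * u (w s) y) = (\<Sum>s<n. L $$ (x, s) * U $$ (w s, y))"
      using v by (intro sum.cong) (auto simp: L_def U_def)
    then show ?thesis
      unfolding p v(1) orbit_point_sum_below[OF l v(2)]
        perm_product_entry[OF carr w v(2,3)] .
  qed
  then show ?thesis using M by blast
qed

text \<open>Taking the Zariski closure does not change the vanishing polynomials, and the matrices of the orbit
  are the corners of the points \<open>orbit_point w l u\<close>, because inverses of upper triangular matrices are upper triangular.\<close>

lemma schubert_ideal_iff:
  assumes w: "w permutes {..<n}"
  shows "f \<in> schubert_ideal n w \<longleftrightarrow>
    f \<in> carrier (polys_in (mat_vars n)) \<and> (\<forall>p\<in>orbit_points w. eval_poly_at p f = 0)"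
proof (cases "f \<in> carrier (polys_in (mat_vars n))")
  case True
  let ?O = "orbit n (perm_matrix n w)"
  have "?O \<subseteq> Mat n"
  proof
    fix M assume "M \<in> ?O"
    then obtain L b where "L \<in> GL n" "b \<in> GL n" and M: "M = L * perm_matrix n w * inv\<^bsub>mat_ring n\<^esub> b"
      unfolding orbit_def Borel_def Borel_opp_def by blast
    then have "L \<in> carrier_mat n n" "inv\<^bsub>mat_ring n\<^esub> b \<in> carrier_mat n n"
      using GL_D(1,2) by blast+
    then show "M \<in> Mat n" unfolding M by (auto simp: perm_matrix_def)
  qed
  have closed: "zariski_closed n {M \<in> Mat n. eval_at_mat M f = 0}"
    unfolding zariski_closed_def by (rule exI[of _ "{f}"]) (use True in auto)
  have "f \<in> schubert_ideal n w \<longleftrightarrow> (\<forall>M\<in>?O. eval_at_mat M f = 0)"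
  proof
    assume "f \<in> schubert_ideal n w"
    then show "\<forall>M\<in>?O. eval_at_mat M f = 0"
      using hull_subset[of ?O "zariski_closed n"]
      unfolding schubert_ideal_def defining_ideal_def matrix_schubert_variety_def by blast
  next
    assume "\<forall>M\<in>?O. eval_at_mat M f = 0"
    then have "?O \<subseteq> {M \<in> Mat n. eval_at_mat M f = 0}" using \<open>?O \<subseteq> Mat n\<close> by blast
    then have "zariski_closed n hull ?O \<subseteq> {M \<in> Mat n. eval_at_mat M f = 0}"
      by (rule hull_minimal[of _ _ "zariski_closed n"]) (rule closed)
    then show "f \<in> schubert_ideal n w"
      using True unfolding schubert_ideal_def defining_ideal_def matrix_schubert_variety_def by blast
  qed
  also have "\<dots> \<longleftrightarrow> (\<forall>p\<in>orbit_points w. eval_poly_at p f = 0)"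
  proof (intro iffI ballI)
    fix p assume van: "\<forall>M\<in>?O. eval_at_mat M f = 0" and p: "p \<in> orbit_points w"
    obtain M where M: "M \<in> ?O" "\<forall>v\<in>mat_vars n. p v = M $$ v" using point_to_orbit[OF w p] by blast
    then have "eval_poly_at p f = eval_at_mat M f"
      unfolding eval_at_mat_def by (intro eval_poly_at_cong[OF True]) blast
    then show "eval_poly_at p f = 0" using van M by simp
  next
    fix M assume van: "\<forall>p\<in>orbit_points w. eval_poly_at p f = 0" and M: "M \<in> ?O"
    obtain p where p: "p \<in> orbit_points w" "\<forall>v\<in>mat_vars n. p v = M $$ v"
      using orbit_to_point[OF w M] by blast
    then have "eval_poly_at p f = eval_at_mat M f"
      unfolding eval_at_mat_def by (intro eval_poly_at_cong[OF True]) blast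
    then show "eval_at_mat M f = 0" using van p by simp
  qed
  finally show ?thesis using True by simp
next
  case False
  then show ?thesis unfolding schubert_ideal_def defining_ideal_def by simp
qed

section \<open>Coordinate rings of matrix Schubert varieties are Hilbertian\<close>

theorem theorem1p3:
  fixes n :: nat and w :: "nat \<Rightarrow> nat"
  assumes "n \<ge> 1" and "w permutes {..<n}"
  shows "hilbertian (mat_vars n) (schubert_ideal n w)"
proof -
  have w: "bij w" using assms(2) by (rule permutes_bij)
  have "w 0 < n" using permutes_in_image[OF assms(2), of 0] assms(1) by simp
  then have v0: "(0, w 0) \<in> mat_vars n" using assms(1) by (simp add: mat_vars_def)
  have ideal: "schubert_ideal n w = vanishing_ideal (mat_vars n) (orbit_points w)"
    using schubert_ideal_iff[OF assms(2)] unfolding vanishing_ideal_def by blast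
  let ?\<F> = "{F. F \<subseteq> mat_vars n - {(0, w 0)} \<and> standard w F}"
  have count: "hilbert_function (mat_vars n) (schubert_ideal n w) k = (\<Sum>F\<in>?\<F>. k choose card F)" for k
    unfolding ideal card_standard_monomials[OF w v0, symmetric]
  proof (rule hilbert_function_eq_card_basis[OF finite_standard_monomials])
    show "orbit_points w \<noteq> {}" using orbit_points_nonempty by blast
  qed (use standard_monomials_independent[OF w] standard_monomials_span
        in \<open>auto simp: standard_monomials_def\<close>)
  obtain b :: "nat \<Rightarrow> rat poly" where b: "\<And>r k. poly (b r) (of_nat k) = of_nat (k choose r)"
    using binomial_poly by metis
  show ?thesis
    by (rule hilbertianI[of _ _ "\<Sum>F\<in>?\<F>. b (card F)"]) (simp add: count poly_sum b)
qed

end
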